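(* Let $\mathcal D_{+}=\{D\in\mathrm{Mat}(n,\mathbb Z_{+})\mid \det D\neq 0\}$ be the set of non-singular $n\times n$ matrices with non-negative integer entries. To each $D=(d_{ij})\in\mathcal D_{+}$ there corresponds a unique $G_{0n}$-orbit of solutions of the classical Yang--Baxter equation of type $\varphi_F$: namely, all the solutions $\varphi_F$ obtained from $n$-tuples $F=(F^1,\dots,F^n)$ of formal Laurent series of the form $$F^i(u)=(u^1)^{-d_{i1}}(u^2)^{-d_{i2}}\cdots(u^n)^{-d_{in}}+\sum_{|\mathbf k|\ge-(d_{i1}+\cdots+d_{in})+1}f^i_{\mathbf k}\,\mathbf u^{\mathbf k},\qquad i=1,\dots,n,$$ lie on one and the same $G_{0n}$-orbit. Moreover, for each $D\in\mathcal D_{+}$ one can choose a canonical triangular $r$-matrix $\varphi_D^{ij}(u,v)\in\mathbb R[u,v]$ (with polynomial entries) representing the $G_{0n}$-orbit labeled by $D$, namely the one obtained from the monomials $F^i(u)=(u^1)^{-d_{i1}}\cdots(u^n)^{-d_{in}}$, $i=1,\dots,n$.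
   Context: $\mathbb Z_+$ denotes the non-negative integers. In the displayed series, $\mathbf k=(k_1,\dots,k_n)\in\mathbb Z^n$ with $k_j\ge -d_{ij}$ for all $j$, $|\mathbf k|=k_1+\cdots+k_n$, $\mathbf u^{\mathbf k}=(u^1)^{k_1}\cdots(u^n)^{k_n}$, and $f^i_{\mathbf k}\in\mathbb R$ are arbitrary. $G_{0n}=FDiff_0(\mathbb R^n)$ is the group, under composition, of formal diffeomorphisms of $\mathbb R^n$ fixing $0$: $n$-tuples $X=(X^1,\dots,X^n)$ of formal power series in $u=(u^1,\dots,u^n)$ without constant term and with invertible linear part. A solution of the classical Yang--Baxter equation (CYBE) for $W_n$ (a triangular $r$-matrix) is a family $\varphi^{ij}(u,v)$, $i,j=1,\dots,n$, with $\varphi^{ij}(u,v)=-\varphi^{ji}(v,u)$ such that for all $i,j,k$, with summation over the repeated index $s=1,\dots,n$ understood, $$\begin{aligned}&\varphi^{ks}(w,u)\frac{\partial \varphi^{ij}(u,v)}{\partial u^s}+\varphi^{sk}(v,w)\frac{\partial \varphi^{ji}(v,u)}{\partial v^s}+\varphi^{is}(u,v)\frac{\partial \varphi^{jk}(v,w)}{\partial v^s}\\&+\varphi^{si}(w,u)\frac{\partial \varphi^{kj}(w,v)}{\partial w^s}+\varphi^{js}(v,w)\frac{\partial \varphi^{ki}(w,u)}{\partial w^s}+\varphi^{sj}(u,v)\frac{\partial \varphi^{ik}(u,w)}{\partial u^s}=0.\end{aligned}$$ For formal Laurent series $F^1,\dots,F^n$ with invertible Jacobian matrix $F_{*u}=(\partial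 F^i/\partial u^j)$, the solution of type $\varphi_F$ obtained from $F$ is $$\varphi_F^{ij}(u,v)=\sum_{k,l=1}^{n}\left(F_{*u}^{-1}\right)^{i}_{k}\left(F_{*v}^{-1}\right)^{j}_{l}\left[F^{k}(u)-F^{l}(v)\right].$$ The group $G_{0n}$ acts on solutions of the CYBE by push-forward of bivector fields: $X\cdot\varphi=\tilde\varphi$ where $\tilde\varphi^{ij}(X(u),X(v))=\sum_{k,l}(X_{*u})^i_k(X_{*v})^j_l\,\varphi^{kl}(u,v)$, with $X_{*u}$ the Jacobian matrix of $X$ at $u$. *)

theory Defs
  imports "HOL-Analysis.Analysis"
begin

section \<open>Formal Laurent series in finitely many variables\<close>

text \<open>
  The type \<open>'v mlaurent\<close> consists of the formal Laurent series with real coefficients in the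
  variables indexed by the finite type \<open>'v\<close>: series in monomials with exponent vectors in
  \<open>int ^ 'v\<close> whose exponents are bounded below.
\<close>

typedef (overloaded) 'v mlaurent =
  "{f :: int ^ 'v::finite \<Rightarrow> real. \<exists>N. \<forall>k j. f k \<noteq> 0 \<longrightarrow> N \<le> k $ j}"
  morphisms mcoeff Abs_mlaurent
  by (rule exI[of _ "\<lambda>_. 0"]) simp

setup_lifting type_definition_mlaurent

lemma mlaurent_eqI: "(\<And>k. mcoeff f k = mcoeff g k) \<Longrightarrow> f = g"
  by (metis mcoeff_inject ext)

lemma mcoeff_bound:
  obtains N where "\<And>k j. mcoeff f k \<noteq> 0 \<Longrightarrow> N \<le> k $ j"
  using mcoeff[of f] by auto

lemma finite_vec_box: "finite {k :: int ^ 'v::finite. \<forall>j. a j \<le> k $ j \<and> k $ j \<le> b j}"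
proof (rule finite_subset)
  show "{k :: int ^ 'v. \<forall>j. a j \<le> k $ j \<and> k $ j \<le> b j}
      \<subseteq> vec_lambda ` (Pi\<^sub>E UNIV (\<lambda>j. {a j..b j}))"
  proof
    fix k :: "int ^ 'v" assume "k \<in> {k. \<forall>j. a j \<le> k $ j \<and> k $ j \<le> b j}"
    then have "vec_nth k \<in> Pi\<^sub>E UNIV (\<lambda>j. {a j..b j})" by auto
    then show "k \<in> vec_lambda ` (Pi\<^sub>E UNIV (\<lambda>j. {a j..b j}))"
      by (metis image_eqI vec_nth_inverse)
  qed
  show "finite (vec_lambda ` (Pi\<^sub>E (UNIV :: 'v set) (\<lambda>j. {a j..b j})))"
    by (intro finite_imageI finite_PiE) auto
qed

lemma finite_mlaurent_conv:
  "finite {l. mcoeff f l \<noteq> 0 \<and> mcoeff g (k - l) \<noteq> 0}"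
proof -
  obtain M where M: "\<And>k j. mcoeff f k \<noteq> 0 \<Longrightarrow> M \<le> k $ j" using mcoeff_bound by blast
  obtain N where N: "\<And>k j. mcoeff g k \<noteq> 0 \<Longrightarrow> N \<le> k $ j" using mcoeff_bound by blast
  have "{l. mcoeff f l \<noteq> 0 \<and> mcoeff g (k - l) \<noteq> 0} \<subseteq> {l. \<forall>j. M \<le> l $ j \<and> l $ j \<le> k $ j - N}"
    using M N by (fastforce simp: algebra_simps)
  then show ?thesis by (rule finite_subset) (rule finite_vec_box)
qed

instantiation mlaurent :: (finite) comm_ring_1
begin

lift_definition zero_mlaurent :: "'a mlaurent" is "\<lambda>_. 0" by simp

lift_definition one_mlaurent :: "'a mlaurent" is "\<lambda>k. if k = 0 then 1 else 0"
  by (rule exI[of _ 0]) auto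

lift_definition plus_mlaurent :: "'a mlaurent \<Rightarrow> 'a mlaurent \<Rightarrow> 'a mlaurent" is "\<lambda>f g k. f k + g k"
proof -
  fix f g :: "int ^ 'a \<Rightarrow> real"
  assume "\<exists>N. \<forall>k j. f k \<noteq> 0 \<longrightarrow> N \<le> k $ j" "\<exists>N. \<forall>k j. g k \<noteq> 0 \<longrightarrow> N \<le> k $ j"
  then obtain M N where
    "\<forall>k j. f k \<noteq> 0 \<longrightarrow> M \<le> k $ j" "\<forall>k j. g k \<noteq> 0 \<longrightarrow> N \<le> k $ j" by blast
  then have "min M N \<le> k $ j" if "f k + g k \<noteq> 0" for k j
    using that by (cases "f k = 0") (auto intro: min.coboundedI1 min.coboundedI2)
  then show "\<exists>N. \<forall>k j. f k + g k \<noteq> 0 \<longrightarrow> N \<le> k $ j" by blast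
qed

lift_definition uminus_mlaurent :: "'a mlaurent \<Rightarrow> 'a mlaurent" is "\<lambda>f k. - f k" by simp

definition minus_mlaurent :: "'a mlaurent \<Rightarrow> 'a mlaurent \<Rightarrow> 'a mlaurent"
  where "minus_mlaurent f g = f + (- g)"

lift_definition times_mlaurent :: "'a mlaurent \<Rightarrow> 'a mlaurent \<Rightarrow> 'a mlaurent"
  is "\<lambda>f g k. \<Sum>l | f l \<noteq> 0 \<and> g (k - l) \<noteq> 0. f l * g (k - l)"
proof -
  fix f g :: "int ^ 'a \<Rightarrow> real"
  assume "\<exists>N. \<forall>k j. f k \<noteq> 0 \<longrightarrow> N \<le> k $ j" "\<exists>N. \<forall>k j. g k \<noteq> 0 \<longrightarrow> N \<le> k $ j"
  then obtain M N where
    M: "\<forall>k j. f k \<noteq> 0 \<longrightarrow> M \<le> k $ j" and N: "\<forall>k j. g k \<noteq> 0 \<longrightarrow> N \<le> k $ j" by blast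
  show "\<exists>N. \<forall>k j. (\<Sum>l | f l \<noteq> 0 \<and> g (k - l) \<noteq> 0. f l * g (k - l)) \<noteq> 0 \<longrightarrow> N \<le> k $ j"
  proof (intro exI allI impI)
    fix k j assume "(\<Sum>l | f l \<noteq> 0 \<and> g (k - l) \<noteq> 0. f l * g (k - l)) \<noteq> 0"
    then obtain l where "f l \<noteq> 0" "g (k - l) \<noteq> 0"
      by (rule sum.not_neutral_contains_not_neutral) blast
    then have "M \<le> l $ j" "N \<le> (k - l) $ j" using M N by blast+
    then show "M + N \<le> k $ j" by simp
  qed
qed

lemma mcoeff_mult_superset:
  fixes f g :: "'a mlaurent"
  assumes "finite S" "\<And>l. mcoeff f l \<noteq> 0 \<Longrightarrow> mcoeff g (k - l) \<noteq> 0 \<Longrightarrow> l \<in> S"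
  shows "mcoeff (f * g) k = (\<Sum>l\<in>S. mcoeff f l * mcoeff g (k - l))"
  unfolding times_mlaurent.rep_eq by (rule sum.mono_neutral_left) (use assms in auto)

lemma mcoeff_mult_nonzeroE:
  fixes f g :: "'a mlaurent"
  assumes "mcoeff (f * g) k \<noteq> 0"
  obtains l where "mcoeff f l \<noteq> 0" "mcoeff g (k - l) \<noteq> 0"
  using assms unfolding times_mlaurent.rep_eq
  by (rule sum.not_neutral_contains_not_neutral) (use that in blast)

instance
proof
  fix f g h :: "'a mlaurent"
  show "f * g = g * f"
  proof (rule mlaurent_eqI)
    fix k :: "int ^ 'a"
    show "mcoeff (f * g) k = mcoeff (g * f) k"
      unfolding times_mlaurent.rep_eq
      by (rule sum.reindex_bij_witness[of _ "\<lambda>l. k - l" "\<lambda>l. k - l"]) (auto simp: mult.commute)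
  qed
  show "f * g * h = f * (g * h)"
  proof (rule mlaurent_eqI)
    fix k :: "int ^ 'a"
    obtain A where A: "\<And>k j. mcoeff f k \<noteq> 0 \<Longrightarrow> A \<le> k $ j" using mcoeff_bound by blast
    obtain B where B: "\<And>k j. mcoeff g k \<noteq> 0 \<Longrightarrow> B \<le> k $ j" using mcoeff_bound by blast
    obtain C where C: "\<And>k j. mcoeff h k \<noteq> 0 \<Longrightarrow> C \<le> k $ j" using mcoeff_bound by blast
    define P where "P = {p. \<forall>j. A \<le> p $ j \<and> p $ j \<le> k $ j - B - C}"
    define L where "L = {l. \<forall>j. A + B \<le> l $ j \<and> l $ j \<le> k $ j - C}"
    have fin: "finite P" "finite L" unfolding P_def L_def by (rule finite_vec_box)+
    have fg_L: "l \<in> L" if "mcoeff (f * g) l \<noteq> 0" "mcoeff h (k - l) \<noteq> 0" for l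
    proof -
      from that(1) obtain p where p: "mcoeff f p \<noteq> 0" "mcoeff g (l - p) \<noteq> 0"
        by (rule mcoeff_mult_nonzeroE)
      have "A + B \<le> l $ j \<and> l $ j \<le> k $ j - C" for j
        using A[OF p(1), of j] B[OF p(2), of j] C[OF that(2), of j] by simp
      then show ?thesis by (simp add: L_def)
    qed
    have gh_P: "p \<in> P" if "mcoeff f p \<noteq> 0" "mcoeff (g * h) (k - p) \<noteq> 0" for p
    proof -
      from that(2) obtain q where q: "mcoeff g q \<noteq> 0" "mcoeff h (k - p - q) \<noteq> 0"
        by (rule mcoeff_mult_nonzeroE)
      have "A \<le> p $ j \<and> p $ j \<le> k $ j - B - C" for j
        using A[OF that(1), of j] B[OF q(1), of j] C[OF q(2), of j] by simp
      then show ?thesis by (simp add: P_def)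
    qed
    have "mcoeff (f * g * h) k = (\<Sum>l\<in>L. mcoeff (f * g) l * mcoeff h (k - l))"
      by (rule mcoeff_mult_superset) (use fin fg_L in auto)
    also have "\<dots> = (\<Sum>l\<in>L. \<Sum>p\<in>P. mcoeff f p * mcoeff g (l - p) * mcoeff h (k - l))"
    proof (rule sum.cong[OF refl])
      fix l assume "l \<in> L"
      show "mcoeff (f * g) l * mcoeff h (k - l)
          = (\<Sum>p\<in>P. mcoeff f p * mcoeff g (l - p) * mcoeff h (k - l))"
      proof (cases "mcoeff h (k - l) = 0")
        case False
        have "mcoeff (f * g) l = (\<Sum>p\<in>P. mcoeff f p * mcoeff g (l - p))"
        proof (rule mcoeff_mult_superset[OF fin(1)])
          fix p assume p: "mcoeff f p \<noteq> 0" "mcoeff g (l - p) \<noteq> 0"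
          have "A \<le> p $ j \<and> p $ j \<le> k $ j - B - C" for j
            using A[OF p(1), of j] B[OF p(2), of j] C[OF False, of j] by simp
          then show "p \<in> P" by (simp add: P_def)
        qed
        then show ?thesis by (simp add: sum_distrib_right)
      qed simp
    qed
    also have "\<dots> = (\<Sum>p\<in>P. \<Sum>l\<in>L. mcoeff f p * mcoeff g (l - p) * mcoeff h (k - l))"
      by (rule sum.swap)
    also have "\<dots> = (\<Sum>p\<in>P. mcoeff f p * mcoeff (g * h) (k - p))"
    proof (rule sum.cong[OF refl])
      fix p assume "p \<in> P"
      show "(\<Sum>l\<in>L. mcoeff f p * mcoeff g (l - p) * mcoeff h (k - l))
          = mcoeff f p * mcoeff (g * h) (k - p)"
      proof (cases "mcoeff f p = 0")
        case False
        have "mcoeff (g * h) (k - p)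
            = (\<Sum>q\<in>(\<lambda>l. l - p) ` L. mcoeff g q * mcoeff h (k - p - q))"
        proof (rule mcoeff_mult_superset)
          fix q assume q: "mcoeff g q \<noteq> 0" "mcoeff h (k - p - q) \<noteq> 0"
          have "A + B \<le> (q + p) $ j \<and> (q + p) $ j \<le> k $ j - C" for j
            using A[OF False, of j] B[OF q(1), of j] C[OF q(2), of j] by simp
          then have "q + p \<in> L" by (simp add: L_def)
          then show "q \<in> (\<lambda>l. l - p) ` L" by (metis add_diff_cancel_right' image_eqI)
        qed (use fin in auto)
        also have "\<dots> = (\<Sum>l\<in>L. mcoeff g (l - p) * mcoeff h (k - l))"
          by (subst sum.reindex) (auto simp: inj_on_def)
        finally show ?thesis by (simp add: sum_distrib_left mult.assoc)
      qed simp
    qed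
    also have "\<dots> = mcoeff (f * (g * h)) k"
      by (rule mcoeff_mult_superset[symmetric]) (use fin gh_P in auto)
    finally show "mcoeff (f * g * h) k = mcoeff (f * (g * h)) k" .
  qed
  show "1 * f = f"
  proof (rule mlaurent_eqI)
    fix k :: "int ^ 'a"
    show "mcoeff (1 * f) k = mcoeff f k"
      by (subst mcoeff_mult_superset[of "{0}"]) (auto simp: one_mlaurent.rep_eq split: if_splits)
  qed
  show "(f + g) * h = f * h + g * h"
  proof (rule mlaurent_eqI)
    fix k :: "int ^ 'a"
    let ?S = "{l. mcoeff f l \<noteq> 0 \<and> mcoeff h (k - l) \<noteq> 0} \<union>
      {l. mcoeff g l \<noteq> 0 \<and> mcoeff h (k - l) \<noteq> 0}"
    have S: "finite ?S" by (simp add: finite_mlaurent_conv)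
    have "mcoeff ((f + g) * h) k = (\<Sum>l\<in>?S. mcoeff (f + g) l * mcoeff h (k - l))"
      by (rule mcoeff_mult_superset[OF S]) (auto simp: plus_mlaurent.rep_eq)
    also have "\<dots> = (\<Sum>l\<in>?S. mcoeff f l * mcoeff h (k - l)) + (\<Sum>l\<in>?S. mcoeff g l * mcoeff h (k - l))"
      by (simp add: plus_mlaurent.rep_eq distrib_right sum.distrib)
    also have "(\<Sum>l\<in>?S. mcoeff f l * mcoeff h (k - l)) = mcoeff (f * h) k"
      by (rule mcoeff_mult_superset[OF S, symmetric]) blast
    also have "(\<Sum>l\<in>?S. mcoeff g l * mcoeff h (k - l)) = mcoeff (g * h) k"
      by (rule mcoeff_mult_superset[OF S, symmetric]) blast
    finally show "mcoeff ((f + g) * h) k = mcoeff (f * h + g * h) k"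
      by (simp add: plus_mlaurent.rep_eq)
  qed
  show "f + g + h = f + (g + h)" by (rule mlaurent_eqI) (simp add: plus_mlaurent.rep_eq)
  show "f + g = g + f" by (rule mlaurent_eqI) (simp add: plus_mlaurent.rep_eq)
  show "0 + f = f" by (rule mlaurent_eqI) (simp add: plus_mlaurent.rep_eq zero_mlaurent.rep_eq)
  show "- f + f = 0"
    by (rule mlaurent_eqI)
      (simp add: plus_mlaurent.rep_eq uminus_mlaurent.rep_eq zero_mlaurent.rep_eq)
  show "f - g = f + - g" by (rule minus_mlaurent_def)
  show "(0 :: 'a mlaurent) \<noteq> 1"
  proof
    assume "(0 :: 'a mlaurent) = 1"
    then have "mcoeff (0 :: 'a mlaurent) 0 = mcoeff 1 0" by simp
    then show False by (simp add: one_mlaurent.rep_eq zero_mlaurent.rep_eq)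
  qed
qed

end

lift_definition mmonom :: "int ^ 'v::finite \<Rightarrow> 'v mlaurent" is "\<lambda>d k. if k = d then 1 else 0"
proof -
  fix d :: "int ^ 'v"
  show "\<exists>N. \<forall>k j. (if k = d then 1 else 0 :: real) \<noteq> 0 \<longrightarrow> N \<le> k $ j"
    by (rule exI[of _ "Min (range (vec_nth d))"]) auto
qed

lift_definition mderiv :: "'v::finite \<Rightarrow> 'v mlaurent \<Rightarrow> 'v mlaurent"
  is "\<lambda>s f k. of_int (k $ s + 1) * f (k + axis s 1)"
proof -
  fix s :: 'v and f :: "int ^ 'v \<Rightarrow> real"
  assume "\<exists>N. \<forall>k j. f k \<noteq> 0 \<longrightarrow> N \<le> k $ j"
  then obtain N where N: "\<And>k j. f k \<noteq> 0 \<Longrightarrow> N \<le> k $ j" by blast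
  show "\<exists>N. \<forall>k j. of_int (k $ s + 1) * f (k + axis s 1) \<noteq> 0 \<longrightarrow> N \<le> k $ j"
  proof (intro exI allI impI)
    fix k j assume "of_int (k $ s + 1) * f (k + axis s 1) \<noteq> 0"
    then have "N \<le> (k + axis s 1) $ j" by (intro N) auto
    then show "N - 1 \<le> k $ j" by (auto simp: axis_def split: if_splits)
  qed
qed

text \<open>
  Renaming of variables along an injection \<open>\<iota>\<close>: the variable \<open>j\<close> becomes the variable \<open>\<iota> j\<close>, so
  the monomials of the result involve no variable outside the range of \<open>\<iota>\<close>.
\<close>

lift_definition mrename :: "('v::finite \<Rightarrow> 'w::finite) \<Rightarrow> 'v mlaurent \<Rightarrow> 'w mlaurent"
  is "\<lambda>\<iota> f m. if \<forall>t. t \<notin> range \<iota> \<longrightarrow> m $ t = 0 then f (\<chi> j. m $ \<iota> j) else 0"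
proof -
  fix \<iota> :: "'v \<Rightarrow> 'w" and f :: "int ^ 'v \<Rightarrow> real"
  assume "\<exists>N. \<forall>k j. f k \<noteq> 0 \<longrightarrow> N \<le> k $ j"
  then obtain N where N: "\<And>k j. f k \<noteq> 0 \<Longrightarrow> N \<le> k $ j" by blast
  show "\<exists>N. \<forall>m t. (if \<forall>t. t \<notin> range \<iota> \<longrightarrow> m $ t = 0 then f (\<chi> j. m $ \<iota> j) else 0) \<noteq> 0
      \<longrightarrow> N \<le> m $ t"
  proof (intro exI[of _ "min N 0"] allI impI)
    fix m t assume *: "(if \<forall>t. t \<notin> range \<iota> \<longrightarrow> m $ t = 0 then f (\<chi> j. m $ \<iota> j) else 0) \<noteq> 0"
    show "min N 0 \<le> m $ t"
    proof (cases "t \<in> range \<iota>")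
      case True
      then obtain j where "t = \<iota> j" by blast
      moreover have "N \<le> (\<chi> j. m $ \<iota> j) $ j" using * by (intro N) (auto split: if_splits)
      ultimately show ?thesis by simp
    next
      case False
      then show ?thesis using * by (auto split: if_splits)
    qed
  qed
qed

definition power_series :: "'v::finite mlaurent \<Rightarrow> bool"
  where "power_series f \<longleftrightarrow> (\<forall>k j. mcoeff f k \<noteq> 0 \<longrightarrow> 0 \<le> k $ j)"

definition polynomial :: "'v::finite mlaurent \<Rightarrow> bool"
  where "polynomial f \<longleftrightarrow> power_series f \<and> finite {k. mcoeff f k \<noteq> 0}"

text \<open>
  Substitution of \<open>Y j\<close> for the variable \<open>j\<close> in a power series \<open>f\<close>. It is meant for power series
  \<open>Y j\<close> without constant term; then for every exponent \<open>m\<close> only finitely many summands are nonzero.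
\<close>

definition msubst :: "'v::finite mlaurent \<Rightarrow> ('v \<Rightarrow> 'w::finite mlaurent) \<Rightarrow> 'w mlaurent"
  where "msubst f Y = Abs_mlaurent (\<lambda>m.
    let c = (\<lambda>k. mcoeff f k * mcoeff (\<Prod>j\<in>UNIV. Y j ^ nat (k $ j)) m)
    in \<Sum>k | c k \<noteq> 0. c k)"


section \<open>Formal diffeomorphisms and triangular r-matrices\<close>

definition mjacobian :: "'n::finite mlaurent ^ 'n \<Rightarrow> 'n mlaurent ^ 'n ^ 'n"
  where "mjacobian F = (\<chi> i j. mderiv j (F $ i))"

definition formal_diffeos :: "('n::finite mlaurent ^ 'n) set"
  where "formal_diffeos = {X. (\<forall>i. power_series (X $ i) \<and> mcoeff (X $ i) 0 = 0) \<and>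
    invertible (\<chi> i j. mcoeff (X $ i) (axis j 1))}"

text \<open>
  A family \<open>\<phi>\<^sup>i\<^sup>j(u,v)\<close> is a matrix of series in the variables \<open>'n + 'n\<close>, where
  \<open>Inl s\<close> stands for \<open>u\<^sup>s\<close> and \<open>Inr s\<close> for \<open>v\<^sup>s\<close>. The term \<open>at_vars x y f\<close> is \<open>f(x,y)\<close>
  for blocks of variables \<open>x\<close> and \<open>y\<close>.
\<close>

type_synonym 'n bivector = "('n + 'n) mlaurent ^ 'n ^ 'n"

definition at_vars :: "('n::finite \<Rightarrow> 'w::finite) \<Rightarrow> ('n \<Rightarrow> 'w) \<Rightarrow> ('n + 'n) mlaurent \<Rightarrow> 'w mlaurent"
  where "at_vars x y f = mrename (case_sum x y) f"

definition cybe_lhs :: "'n::finite bivector \<Rightarrow> 'n \<Rightarrow> 'n \<Rightarrow> 'n \<Rightarrow> ('n + 'n + 'n) mlaurent"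
  where "cybe_lhs \<phi> i j k =
    (let u = Inl; v = (\<lambda>s. Inr (Inl s)); w = (\<lambda>s. Inr (Inr s)) in
     \<Sum>s\<in>UNIV.
       at_vars w u (\<phi> $ k $ s) * mderiv (u s) (at_vars u v (\<phi> $ i $ j))
     + at_vars v w (\<phi> $ s $ k) * mderiv (v s) (at_vars v u (\<phi> $ j $ i))
     + at_vars u v (\<phi> $ i $ s) * mderiv (v s) (at_vars v w (\<phi> $ j $ k))
     + at_vars w u (\<phi> $ s $ i) * mderiv (w s) (at_vars w v (\<phi> $ k $ j))
     + at_vars v w (\<phi> $ j $ s) * mderiv (w s) (at_vars w u (\<phi> $ k $ i))
     + at_vars u v (\<phi> $ s $ j) * mderiv (u s) (at_vars u w (\<phi> $ i $ k)))"

text \<open>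
  Elements of \<open>W\<^sub>n\<close> are formal vector fields with power series coefficients, so the entries of
  a solution are required to be power series in \<open>u\<close> and \<open>v\<close>.
\<close>

definition power_series_bivector :: "'n::finite bivector \<Rightarrow> bool"
  where "power_series_bivector \<phi> \<longleftrightarrow> (\<forall>i j. power_series (\<phi> $ i $ j))"

definition cybe_solutions :: "'n::finite bivector set"
  where "cybe_solutions = {\<phi>. power_series_bivector \<phi> \<and>
    (\<forall>i j. \<phi> $ i $ j = - at_vars Inr Inl (\<phi> $ j $ i)) \<and>
    (\<forall>i j k. cybe_lhs \<phi> i j k = 0)}"

text \<open>
  The relation \<open>X \<cdot> \<phi> = \<psi>\<close>, in the form \<open>\<psi>(X(u),X(v)) = (X\<^sub>*\<^sub>u \<otimes> X\<^sub>*\<^sub>v) \<phi>(u,v)\<close>. The substitution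
  on the left is only meaningful for power series \<open>\<psi>\<close>, which is why that is demanded.
\<close>

definition push_forward :: "'n::finite mlaurent ^ 'n \<Rightarrow> 'n bivector \<Rightarrow> 'n bivector \<Rightarrow> bool"
  where "push_forward X \<phi> \<psi> \<longleftrightarrow> power_series_bivector \<psi> \<and>
    (\<forall>i j. msubst (\<psi> $ i $ j) (case_sum (\<lambda>s. mrename Inl (X $ s)) (\<lambda>s. mrename Inr (X $ s))) =
      (\<Sum>k\<in>UNIV. \<Sum>l\<in>UNIV.
        mrename Inl (mjacobian X $ i $ k) * mrename Inr (mjacobian X $ j $ l) * \<phi> $ k $ l))"

definition solution_orbits :: "'n::finite bivector set set"
  where "solution_orbits =
    {{\<psi>. \<exists>X\<in>formal_diffeos. push_forward X \<phi> \<psi>} | \<phi>. \<phi> \<in> cybe_solutions}"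


section \<open>Solutions obtained from tuples of Laurent series\<close>

definition phi_of :: "'n::finite mlaurent ^ 'n \<Rightarrow> 'n bivector"
  where "phi_of F = (\<chi> i j. \<Sum>k\<in>UNIV. \<Sum>l\<in>UNIV.
    mrename Inl (matrix_inv (mjacobian F) $ i $ k) * mrename Inr (matrix_inv (mjacobian F) $ j $ l) *
    (mrename Inl (F $ k) - mrename Inr (F $ l)))"

definition nonsingular_nat_matrices :: "(nat ^ 'n ^ 'n::finite) set"
  where "nonsingular_nat_matrices = {D. det (\<chi> i j. int (D $ i $ j)) \<noteq> 0}"

definition neg_row :: "nat ^ 'n ^ 'n \<Rightarrow> 'n \<Rightarrow> int ^ 'n::finite"
  where "neg_row D i = (\<chi> j. - int (D $ i $ j))"

definition monomial_tuple :: "nat ^ 'n ^ 'n \<Rightarrow> 'n::finite mlaurent ^ 'n"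
  where "monomial_tuple D = (\<chi> i. mmonom (neg_row D i))"

text \<open>
  The tuples \<open>F\<close> whose \<open>i\<close>-th entry is the monomial with exponents \<open>- d\<^sub>i\<^sub>j\<close> plus an
  arbitrary series, with coefficients \<open>f i k\<close>, in the monomials of higher total degree with
  \<open>k\<^sub>j \<ge> - d\<^sub>i\<^sub>j\<close>.
\<close>

definition tuples_of_type :: "nat ^ 'n ^ 'n \<Rightarrow> ('n::finite mlaurent ^ 'n) set"
  where "tuples_of_type D = {F. \<exists>f :: 'n \<Rightarrow> int ^ 'n \<Rightarrow> real. \<forall>i k.
    mcoeff (F $ i) k = mcoeff (mmonom (neg_row D i)) k +
      (if (\<forall>j. k $ j \<ge> - int (D $ i $ j)) \<and>
          (\<Sum>j\<in>UNIV. k $ j) \<ge> - (\<Sum>j\<in>UNIV. int (D $ i $ j)) + 1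
       then f i k else 0)}"

end

theory Submission
  imports Defs
begin

text \<open>
  Put \<open>\<alpha> = \<Sum>\<^sub>k \<partial>/\<partial>F\<^sup>k\<close> and \<open>\<beta> = \<Sum>\<^sub>k F\<^sup>k \<partial>/\<partial>F\<^sup>k\<close>, the generators of diagonal translation and of
  dilation in the coordinates \<open>F\<close>. The double sum that defines \<open>\<phi>\<^sub>F\<close> factorises
  (\<open>phi_of_eq_wedge\<close>): it is the bivector \<open>\<beta>(u) \<otimes> \<alpha>(v) - \<alpha>(u) \<otimes> \<beta>(v)\<close>. Since \<open>[\<alpha>,\<beta>] = \<alpha>\<close>
  (\<open>euler_translation_bracket\<close>), this is the triangular r-matrix of a two-dimensional Lie algebra,
  and the classical Yang--Baxter equation holds (\<open>cybe_lhs_wedge\<close>).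

  For the orbits, every tuple \<open>F\<close> of type \<open>D\<close> becomes the tuple of pure monomials after a formal
  change of coordinates \<open>X\<close> (\<open>monomial_coordinates\<close>). With \<open>F\<^sup>i = u\<^bsup>-d\<^sub>i\<^esup> P\<^sub>i\<close> and
  \<open>X\<^sup>j = u\<^sup>j h\<^sub>j\<close>, this amounts to solving \<open>\<Prod>\<^sub>j h\<^sub>j\<^bsup>d\<^sub>i\<^sub>j\<^esup> = 1/P\<^sub>i\<close> in power series with constant
  term \<open>1\<close>, which is possible because \<open>D\<close> is invertible over the reals; the formal inverse function
  theorem provides the solution. In these coordinates \<open>\<alpha>\<close> and \<open>\<beta>\<close> are explicit polynomial vector
  fields that depend on \<open>D\<close> only (\<open>fields_of_monomial_coordinates\<close>). Hence \<open>X\<close> pushes \<open>\<phi>\<^sub>F\<close> forward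
  to the polynomial solution given by the monomials, and pulling back shows that \<open>\<phi>\<^sub>F\<close> has power
  series entries although \<open>F\<close> has poles. The orbit is unique because formal diffeomorphisms form a
  group that acts by push-forward (\<open>push_forward_mcompose\<close>, \<open>push_forward_inverse\<close>), so that orbits
  with a common element coincide (\<open>orbit_eq\<close>).

  The calculus of power series needed for this, in particular substitution with its associativity
  and chain rule, rests on one principle: a linear map that respects the order of vanishing up to a
  constant is determined by its values on monomials (\<open>filtered_linear_eq_monomialsI\<close>). Units and inverse functions come
  from the contraction principle (\<open>contraction_fixed_point\<close>).
\<close>

section \<open>Matrices over a ring\<close>

lemma matrix_inv_invertible:
  fixes A :: "'a::semiring_1 ^ 'n ^ 'm"
  assumes "invertible A"
  shows "A ** matrix_inv A = mat 1" "matrix_inv A ** A = mat 1"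
  using someI_ex[OF assms[unfolded invertible_def]] by (simp_all add: matrix_inv_def)

lemma matrix_mult_sum:
  fixes A :: "'a::semiring_1 ^ 'm ^ 'n" and B :: "'a ^ 'l ^ 'm"
  shows "(\<Sum>i\<in>UNIV. A $ p $ i * (\<Sum>k\<in>UNIV. B $ i $ k * x k)) = (\<Sum>k\<in>UNIV. (A ** B) $ p $ k * x k)"
  unfolding matrix_matrix_mult_def
  by (simp add: sum_distrib_left sum_distrib_right mult.assoc) (rule sum.swap)

lemma mat_1_sum:
  fixes x :: "'n::finite \<Rightarrow> 'a::semiring_1"
  shows "(\<Sum>k\<in>UNIV. mat 1 $ i $ k * x k) = x i"
proof -
  have "(\<Sum>k\<in>UNIV. mat 1 $ i $ k * x k) = (\<Sum>k\<in>UNIV. if i = k then x k else 0)"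
    by (rule sum.cong) (auto simp: mat_def)
  then show ?thesis by simp
qed

text \<open>The matrix obtained by applying \<open>h\<close> to every entry.\<close>

definition map_entries :: "('a \<Rightarrow> 'b) \<Rightarrow> 'a ^ 'n ^ 'm \<Rightarrow> 'b ^ 'n ^ 'm"
  where "map_entries h A = (\<chi> i j. h (A $ i $ j))"

lemma map_entries_nth [simp]: "map_entries h A $ i $ j = h (A $ i $ j)"
  by (simp add: map_entries_def)

section \<open>The ring of formal Laurent series\<close>

lemmas mcoeff_simps = plus_mlaurent.rep_eq zero_mlaurent.rep_eq one_mlaurent.rep_eq
  uminus_mlaurent.rep_eq

lemma mcoeff_diff: "mcoeff (f - g) k = mcoeff f k - mcoeff g k"
  unfolding minus_mlaurent_def[of f g] by (simp only: mcoeff_simps)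

lemma mcoeff_sum: "mcoeff (sum f A) k = (\<Sum>a\<in>A. mcoeff (f a) k)"
  by (induction A rule: infinite_finite_induct) (auto simp: mcoeff_simps)

text \<open>The constant series with value \<open>c\<close>.\<close>

lift_definition mconst :: "real \<Rightarrow> 'v::finite mlaurent" is "\<lambda>c k. if k = 0 then c else 0"
  by (rule exI[of _ 0]) auto

text \<open>The variable \<open>j\<close> as a series.\<close>

definition mvar :: "'v::finite \<Rightarrow> 'v mlaurent"
  where "mvar j = mmonom (axis j 1)"

lemma mcoeff_mconst_mult: "mcoeff (mconst c * f) k = c * mcoeff f k"
  by (subst mcoeff_mult_superset[of "{0}"]) (auto simp: mconst.rep_eq split: if_splits)

lemma mcoeff_mmonom_mult: "mcoeff (mmonom d * f) k = mcoeff f (k - d)"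
  by (subst mcoeff_mult_superset[of "{d}"]) (auto simp: mmonom.rep_eq split: if_splits)

lemma mmonom_mult: "mmonom d * mmonom e = mmonom (d + e)"
  by (rule mlaurent_eqI) (auto simp: mcoeff_mmonom_mult mmonom.rep_eq algebra_simps)

lemma mmonom_0: "mmonom 0 = 1"
  by (rule mlaurent_eqI) (simp add: mmonom.rep_eq one_mlaurent.rep_eq)

lemma mmonom_inverse: "mmonom d * mmonom (- d) = 1"
  by (simp add: mmonom_mult mmonom_0)

lemma mconst_1 [simp]: "mconst 1 = 1"
  by (rule mlaurent_eqI) (simp add: mconst.rep_eq one_mlaurent.rep_eq)

lemma mconst_0 [simp]: "mconst 0 = 0"
  by (rule mlaurent_eqI) (simp add: mconst.rep_eq zero_mlaurent.rep_eq)

lemma mconst_add: "mconst (a + b) = mconst a + mconst b"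
  by (rule mlaurent_eqI) (simp add: mconst.rep_eq mcoeff_simps)

lemma mconst_mult: "mconst (a * b) = mconst a * mconst b"
  by (rule mlaurent_eqI) (simp add: mcoeff_mconst_mult, simp add: mconst.rep_eq)

lemma mconst_minus: "mconst (- a) = - mconst a"
  by (rule mlaurent_eqI) (simp add: mconst.rep_eq mcoeff_simps)

lemma mconst_of_nat: "mconst (of_nat n) = of_nat n"
  by (induction n) (simp_all add: mconst_add)

lemma mconst_sum: "mconst (sum f A) = (\<Sum>a\<in>A. mconst (f a))"
  by (induction A rule: infinite_finite_induct) (auto simp: mconst_add)

lemma mcoeff_mconst_0 [simp]: "mcoeff (mconst c) 0 = c"
  by (simp add: mconst.rep_eq)

lemma prod_mmonom: "(\<Prod>j\<in>A. mmonom (d j)) = mmonom (\<Sum>j\<in>A. d j)"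
  by (induction A rule: infinite_finite_induct) (auto simp: mmonom_mult mmonom_0)

lemma mmonom_power: "mmonom d ^ n = mmonom (of_nat n *s d)"
proof (induction n)
  case 0
  then show ?case by (simp add: mmonom_0)
next
  case (Suc n)
  have "d + of_nat n *s d = of_nat (Suc n) *s d"
    by (simp add: vec_eq_iff algebra_simps)
  then show ?case using Suc by (simp add: mmonom_mult)
qed

lemma prod_mvar_power: "(\<Prod>j\<in>UNIV. mvar j ^ n j) = mmonom (\<chi> j. int (n j))"
proof -
  have "(\<Sum>j\<in>UNIV. of_nat (n j) *s axis j 1) = (\<chi> j. int (n j))"
    by (simp add: vec_eq_iff axis_def if_distrib[of "\<lambda>x. _ * x"] sum.delta' cong: if_cong)
  then show ?thesis by (simp add: mvar_def mmonom_power prod_mmonom)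
qed

section \<open>Partial derivatives and renaming of variables\<close>

lemma mderiv_add: "mderiv s (f + g) = mderiv s f + mderiv s g"
  by (rule mlaurent_eqI) (simp add: mderiv.rep_eq mcoeff_simps algebra_simps)

lemma mderiv_0 [simp]: "mderiv s 0 = 0"
  by (rule mlaurent_eqI) (simp add: mderiv.rep_eq mcoeff_simps)

lemma mderiv_diff: "mderiv s (f - g) = mderiv s f - mderiv s g"
  by (rule mlaurent_eqI) (simp add: mderiv.rep_eq mcoeff_diff algebra_simps)

lemma mderiv_sum: "mderiv s (sum f A) = (\<Sum>a\<in>A. mderiv s (f a))"
  by (induction A rule: infinite_finite_induct) (auto simp: mderiv_add)

lemma mderiv_mconst [simp]: "mderiv s (mconst c) = 0"
proof (rule mlaurent_eqI)
  fix k :: "int ^ 'a"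
  show "mcoeff (mderiv s (mconst c)) k = mcoeff 0 k"
  proof (cases "k + axis s 1 = 0")
    case True
    then have "(k + axis s 1) $ s = 0" by simp
    then have "k $ s + 1 = 0" by simp
    then have "real_of_int (k $ s) + 1 = 0" by linarith
    then show ?thesis by (simp add: mderiv.rep_eq mcoeff_simps)
  qed (simp add: mderiv.rep_eq mcoeff_simps mconst.rep_eq)
qed

lemma mderiv_1 [simp]: "mderiv s 1 = 0"
  using mderiv_mconst[of s 1] by simp

lemma mderiv_mult: "mderiv s (f * g) = mderiv s f * g + f * mderiv s g"
proof (rule mlaurent_eqI)
  fix k :: "int ^ 'a"
  define e :: "int ^ 'a" where "e = axis s 1"
  have e: "e $ s = 1" by (simp add: e_def)
  define S where "S = {l. mcoeff f l \<noteq> 0 \<and> mcoeff g (k + e - l) \<noteq> 0}"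
  have S: "finite S" unfolding S_def by (rule finite_mlaurent_conv)
  have "mcoeff (mderiv s (f * g)) k
      = of_int (k $ s + 1) * (\<Sum>l\<in>S. mcoeff f l * mcoeff g (k + e - l))"
    unfolding mderiv.rep_eq e_def[symmetric]
    by (subst mcoeff_mult_superset[OF S]) (auto simp: S_def)
  also have "\<dots> = (\<Sum>l\<in>S. of_int (l $ s) * mcoeff f l * mcoeff g (k + e - l))
      + (\<Sum>l\<in>S. mcoeff f l * (of_int (k $ s - l $ s + 1) * mcoeff g (k + e - l)))"
    by (simp add: sum_distrib_left sum.distrib[symmetric] algebra_simps)
  also have "(\<Sum>l\<in>S. mcoeff f l * (of_int (k $ s - l $ s + 1) * mcoeff g (k + e - l)))
      = mcoeff (f * mderiv s g) k"
    by (subst mcoeff_mult_superset[OF S])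
      (auto simp: S_def mderiv.rep_eq e_def algebra_simps)
  also have "(\<Sum>l\<in>S. of_int (l $ s) * mcoeff f l * mcoeff g (k + e - l))
      = (\<Sum>l\<in>(\<lambda>l. l - e) ` S. mcoeff (mderiv s f) l * mcoeff g (k - l))"
    by (subst sum.reindex)
      (auto simp: inj_on_def mderiv.rep_eq e e_def[symmetric] algebra_simps)
  also have "\<dots> = mcoeff (mderiv s f * g) k"
  proof (rule mcoeff_mult_superset[symmetric])
    fix l assume "mcoeff (mderiv s f) l \<noteq> 0" "mcoeff g (k - l) \<noteq> 0"
    then have "l + e \<in> S" by (auto simp: S_def mderiv.rep_eq e_def)
    then show "l \<in> (\<lambda>l. l - e) ` S" by (metis add_diff_cancel_right' image_eqI)
  qed (use S in auto)
  finally show "mcoeff (mderiv s (f * g)) k = mcoeff (mderiv s f * g + f * mderiv s g) k"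
    by (simp add: mcoeff_simps)
qed

lemma mderiv_commute: "mderiv s (mderiv t f) = mderiv t (mderiv s f)"
  by (rule mlaurent_eqI) (simp add: mderiv.rep_eq axis_def ac_simps)

lemma mderiv_mmonom: "mderiv s (mmonom d) = mconst (of_int (d $ s)) * mmonom (d - axis s 1)"
  by (rule mlaurent_eqI)
    (auto simp: mderiv.rep_eq mcoeff_mconst_mult mmonom.rep_eq)

lemma mderiv_mvar: "mderiv s (mvar j) = (if s = j then 1 else 0)"
  by (simp add: mvar_def mderiv_mmonom mmonom_0) (simp add: axis_def)

lemma mderiv_power: "mderiv s (f ^ n) = of_nat n * f ^ (n - 1) * mderiv s f"
proof (induction n)
  case (Suc n)
  then show ?case by (cases n) (simp_all add: mderiv_mult algebra_simps)
qed simp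

lemma mcoeff_mrename_cases:
  obtains "\<And>f. mcoeff (mrename \<iota> f) m = mcoeff f (\<chi> j. m $ \<iota> j)"
    | "\<And>f. mcoeff (mrename \<iota> f) m = 0"
proof (cases "\<forall>t. t \<notin> range \<iota> \<longrightarrow> m $ t = 0")
  case True
  then show ?thesis by (intro that(1)) (simp add: mrename.rep_eq)
next
  case False
  then show ?thesis by (intro that(2)) (auto simp: mrename.rep_eq)
qed

lemma mrename_add: "mrename \<iota> (f + g) = mrename \<iota> f + mrename \<iota> g"
proof (rule mlaurent_eqI)
  show "mcoeff (mrename \<iota> (f + g)) m = mcoeff (mrename \<iota> f + mrename \<iota> g) m" for m
    by (rule mcoeff_mrename_cases[of \<iota> m]) (simp_all add: mcoeff_simps)
qed

lemma mrename_minus: "mrename \<iota> (- f) = - mrename \<iota> f"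
proof (rule mlaurent_eqI)
  show "mcoeff (mrename \<iota> (- f)) m = mcoeff (- mrename \<iota> f) m" for m
    by (rule mcoeff_mrename_cases[of \<iota> m]) (simp_all add: mcoeff_simps)
qed

lemma mrename_diff: "mrename \<iota> (f - g) = mrename \<iota> f - mrename \<iota> g"
  using mrename_add[of \<iota> f "- g"] by (simp add: mrename_minus)

lemma mrename_0 [simp]: "mrename \<iota> 0 = 0"
  by (rule mlaurent_eqI) (simp add: mrename.rep_eq mcoeff_simps)

lemma mrename_sum: "mrename \<iota> (sum f A) = (\<Sum>a\<in>A. mrename \<iota> (f a))"
  by (induction A rule: infinite_finite_induct) (auto simp: mrename_add)

lemma mrename_mconst [simp]:
  fixes \<iota> :: "'v::finite \<Rightarrow> 'w::finite"
  shows "mrename \<iota> (mconst c) = mconst c"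
proof (rule mlaurent_eqI)
  fix m :: "int ^ 'w"
  have "m = 0 \<longleftrightarrow> (\<forall>t. t \<notin> range \<iota> \<longrightarrow> m $ t = 0) \<and> (\<chi> j. m $ \<iota> j) = 0"
  proof (intro iffI conjI)
    assume *: "(\<forall>t. t \<notin> range \<iota> \<longrightarrow> m $ t = 0) \<and> (\<chi> j. m $ \<iota> j) = 0"
    have "m $ t = 0" for t
    proof (cases "t \<in> range \<iota>")
      case True
      then obtain j where "t = \<iota> j" by blast
      moreover have "(\<chi> j. m $ \<iota> j) $ j = 0 $ j" using * by simp
      ultimately show ?thesis by simp
    qed (use * in blast)
    then show "m = 0" by (simp add: vec_eq_iff)
  qed (simp_all add: vec_eq_iff)
  then show "mcoeff (mrename \<iota> (mconst c)) m = mcoeff (mconst c) m"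
    by (auto simp: mrename.rep_eq mconst.rep_eq)
qed

lemma mrename_1 [simp]: "mrename \<iota> 1 = 1"
  using mrename_mconst[of \<iota> 1] by simp

text \<open>
  The exponent vector that extends \<open>k\<close> by zero along \<open>\<iota>\<close>; it is meant for injective \<open>\<iota>\<close>.
\<close>

definition extend_exponent :: "('v::finite \<Rightarrow> 'w::finite) \<Rightarrow> int ^ 'v \<Rightarrow> int ^ 'w"
  where "extend_exponent \<iota> k = (\<chi> t. if t \<in> range \<iota> then k $ inv \<iota> t else 0)"

lemma extend_exponent_nth:
  assumes "inj \<iota>"
  shows "extend_exponent \<iota> k $ \<iota> j = k $ j" "t \<notin> range \<iota> \<Longrightarrow> extend_exponent \<iota> k $ t = 0"
  using assms by (auto simp: extend_exponent_def)

lemma extend_exponent_restrict: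
  assumes "inj \<iota>" "\<forall>t. t \<notin> range \<iota> \<longrightarrow> m $ t = 0"
  shows "extend_exponent \<iota> (\<chi> j. m $ \<iota> j) = m"
  using assms by (auto simp: extend_exponent_def vec_eq_iff)

lemma mcoeff_mrename_extend:
  assumes "inj \<iota>"
  shows "mcoeff (mrename \<iota> f) (extend_exponent \<iota> k) = mcoeff f k"
  using assms by (auto simp: mrename.rep_eq extend_exponent_nth)

lemma mcoeff_mrename_nonzeroE:
  assumes "inj \<iota>" "mcoeff (mrename \<iota> f) m \<noteq> 0"
  obtains k where "m = extend_exponent \<iota> k" "mcoeff f k \<noteq> 0"
proof -
  have *: "\<forall>t. t \<notin> range \<iota> \<longrightarrow> m $ t = 0" "mcoeff f (\<chi> j. m $ \<iota> j) \<noteq> 0"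
    using assms(2) unfolding mrename.rep_eq by presburger+
  show ?thesis
    using that[OF extend_exponent_restrict[OF assms(1) *(1), symmetric] *(2)] .
qed

lemma mlaurent_rename_eqI:
  assumes "inj \<iota>" "\<And>k. mcoeff g (extend_exponent \<iota> k) = mcoeff f k"
    "\<And>m t. mcoeff g m \<noteq> 0 \<Longrightarrow> t \<notin> range \<iota> \<Longrightarrow> m $ t = 0"
  shows "mrename \<iota> f = g"
proof (rule mlaurent_eqI)
  fix m
  show "mcoeff (mrename \<iota> f) m = mcoeff g m"
  proof (cases "\<forall>t. t \<notin> range \<iota> \<longrightarrow> m $ t = 0")
    case True
    then show ?thesis
      using assms(2)[of "\<chi> j. m $ \<iota> j"] extend_exponent_restrict[OF assms(1) True]
      by (simp add: mrename.rep_eq)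
  next
    case False
    then have "mcoeff g m = 0" using assms(3) by blast
    then show ?thesis using False by (auto simp: mrename.rep_eq)
  qed
qed

lemma mrename_mult:
  assumes "inj \<iota>"
  shows "mrename \<iota> (f * g) = mrename \<iota> f * mrename \<iota> g"
proof (rule mlaurent_rename_eqI[OF assms])
  fix k
  let ?E = "extend_exponent \<iota>"
  have inj: "inj ?E"
    by (rule injI) (metis assms extend_exponent_nth(1) vec_eq_iff)
  have E_diff: "?E k - ?E l = ?E (k - l)" for l
    by (simp add: vec_eq_iff extend_exponent_def)
  define S where "S = {l. mcoeff f l \<noteq> 0 \<and> mcoeff g (k - l) \<noteq> 0}"
  have S: "finite S" unfolding S_def by (rule finite_mlaurent_conv)
  have "mcoeff (mrename \<iota> f * mrename \<iota> g) (?E k)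
      = (\<Sum>l\<in>?E ` S. mcoeff (mrename \<iota> f) l * mcoeff (mrename \<iota> g) (?E k - l))"
  proof (rule mcoeff_mult_superset)
    fix m assume m: "mcoeff (mrename \<iota> f) m \<noteq> 0" "mcoeff (mrename \<iota> g) (?E k - m) \<noteq> 0"
    from m(1) obtain l where "m = ?E l" "mcoeff f l \<noteq> 0"
      by (rule mcoeff_mrename_nonzeroE[OF assms])
    then show "m \<in> ?E ` S" using m(2)
      by (auto simp: S_def E_diff mcoeff_mrename_extend[OF assms])
  qed (use S in auto)
  also have "\<dots> = (\<Sum>l\<in>S. mcoeff f l * mcoeff g (k - l))"
    by (subst sum.reindex)
      (auto intro: inj_on_subset[OF inj] simp: E_diff mcoeff_mrename_extend[OF assms])
  also have "\<dots> = mcoeff (f * g) k"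
    by (rule mcoeff_mult_superset[OF S, symmetric]) (auto simp: S_def)
  finally show "mcoeff (mrename \<iota> f * mrename \<iota> g) (?E k) = mcoeff (f * g) k" .
next
  fix m t assume "mcoeff (mrename \<iota> f * mrename \<iota> g) m \<noteq> 0" and t: "t \<notin> range \<iota>"
  from this(1) obtain l where
    "mcoeff (mrename \<iota> f) l \<noteq> 0" "mcoeff (mrename \<iota> g) (m - l) \<noteq> 0"
    by (rule mcoeff_mult_nonzeroE)
  then have "l $ t = 0" "(m - l) $ t = 0" using t by (auto simp: mrename.rep_eq split: if_splits)
  then show "m $ t = 0" by simp
qed

lemma mrename_mvar:
  assumes "inj \<iota>"
  shows "mrename \<iota> (mvar j) = mvar (\<iota> j)"
proof (rule mlaurent_rename_eqI[OF assms])
  fix k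
  have "extend_exponent \<iota> k = axis (\<iota> j) 1 \<longleftrightarrow> k = axis j 1"
  proof
    assume *: "extend_exponent \<iota> k = axis (\<iota> j) 1"
    have "k $ i = axis j 1 $ i" for i
      using extend_exponent_nth(1)[OF assms, of k i] assms by (auto simp: * axis_def inj_eq)
    then show "k = axis j 1" by (simp add: vec_eq_iff)
  qed (use assms in \<open>auto simp: vec_eq_iff axis_def extend_exponent_def\<close>)
  then show "mcoeff (mvar (\<iota> j)) (extend_exponent \<iota> k) = mcoeff (mvar j) k"
    by (simp add: mvar_def mmonom.rep_eq)
next
  fix m t assume "mcoeff (mvar (\<iota> j)) m \<noteq> 0" "t \<notin> range \<iota>"
  then show "m $ t = 0" by (auto simp: mvar_def mmonom.rep_eq axis_def split: if_splits)
qed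

lemma mrename_mrename:
  assumes "inj \<iota>" "inj \<kappa>"
  shows "mrename \<kappa> (mrename \<iota> f) = mrename (\<kappa> \<circ> \<iota>) f"
proof (rule mlaurent_eqI)
  fix m :: "int ^ 'c"
  have "(\<forall>t. t \<notin> range (\<kappa> \<circ> \<iota>) \<longrightarrow> m $ t = 0) \<longleftrightarrow>
      (\<forall>t. t \<notin> range \<kappa> \<longrightarrow> m $ t = 0) \<and> (\<forall>t. t \<notin> range \<iota> \<longrightarrow> m $ \<kappa> t = 0)" (is "?L = ?R")
  proof
    assume L: ?L
    have "m $ \<kappa> t = 0" if "t \<notin> range \<iota>" for t
    proof -
      have "\<kappa> t \<notin> range (\<kappa> \<circ> \<iota>)" using that assms(2) by (auto simp: inj_eq)
      then show ?thesis using L by blast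
    qed
    then show ?R using L by auto
  next
    assume R: ?R
    show ?L
    proof (intro allI impI)
      fix t assume t: "t \<notin> range (\<kappa> \<circ> \<iota>)"
      show "m $ t = 0"
      proof (cases "t \<in> range \<kappa>")
        case True
        then obtain s where "t = \<kappa> s" by blast
        moreover have "s \<notin> range \<iota>" using t calculation by auto
        ultimately show ?thesis using R by blast
      qed (use R in blast)
    qed
  qed
  then show "mcoeff (mrename \<kappa> (mrename \<iota> f)) m = mcoeff (mrename (\<kappa> \<circ> \<iota>) f) m"
    by (auto simp: mrename.rep_eq)
qed

lemma mderiv_mrename:
  assumes "inj \<iota>"
  shows "mderiv (\<iota> j) (mrename \<iota> f) = mrename \<iota> (mderiv j f)"
proof (rule mlaurent_eqI)
  fix m :: "int ^ 'b"
  have notin: "(m + axis (\<iota> j) 1) $ t = m $ t" if "t \<notin> range \<iota>" for t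
  proof -
    have "t \<noteq> \<iota> j" using that by blast
    then show ?thesis by (simp add: axis_def)
  qed
  have shift: "(\<chi> i. (m + axis (\<iota> j) 1) $ \<iota> i) = (\<chi> i. m $ \<iota> i) + axis j 1"
    using assms by (simp add: vec_eq_iff axis_def inj_eq)
  show "mcoeff (mderiv (\<iota> j) (mrename \<iota> f)) m = mcoeff (mrename \<iota> (mderiv j f)) m"
  proof (cases "\<forall>t. t \<notin> range \<iota> \<longrightarrow> m $ t = 0")
    case True
    then have "\<forall>t. t \<notin> range \<iota> \<longrightarrow> (m + axis (\<iota> j) 1) $ t = 0" using notin by metis
    then show ?thesis
      unfolding mderiv.rep_eq mrename.rep_eq shift using True by simp
  next
    case False
    then have *: "\<not> (\<forall>t. t \<notin> range \<iota> \<longrightarrow> (m + axis (\<iota> j) 1) $ t = 0)" using notin by metis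
    show ?thesis
      unfolding mderiv.rep_eq mrename.rep_eq shift if_not_P[OF *] if_not_P[OF False] by simp
  qed
qed

lemma mderiv_mrename_notin:
  assumes "t \<notin> range \<iota>"
  shows "mderiv t (mrename \<iota> f) = 0"
proof (rule mlaurent_eqI)
  fix m
  show "mcoeff (mderiv t (mrename \<iota> f)) m = mcoeff 0 m"
  proof (cases "m $ t + 1 = 0")
    case True
    then have "real_of_int (m $ t) + 1 = 0" by linarith
    then show ?thesis by (simp add: mderiv.rep_eq mcoeff_simps)
  next
    case False
    then have "(m + axis t 1) $ t \<noteq> 0" by simp
    then have "mcoeff (mrename \<iota> f) (m + axis t 1) = 0"
      unfolding mrename.rep_eq using assms by meson
    then show ?thesis by (simp add: mderiv.rep_eq mcoeff_simps)
  qed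
qed

section \<open>Power series filtered by the order of vanishing\<close>

text \<open>The total degree of a Laurent monomial; it can be negative.\<close>

definition total_degree :: "int ^ 'v::finite \<Rightarrow> int"
  where "total_degree k = (\<Sum>j\<in>UNIV. k $ j)"

text \<open>The power series all of whose monomials have total degree at least \<open>n\<close>.\<close>

definition order_ge :: "nat \<Rightarrow> 'v::finite mlaurent \<Rightarrow> bool"
  where "order_ge n f \<longleftrightarrow>
    (\<forall>k. mcoeff f k \<noteq> 0 \<longrightarrow> (\<forall>j. 0 \<le> k $ j) \<and> int n \<le> total_degree k)"

lemma order_geD:
  assumes "order_ge n f" "mcoeff f k \<noteq> 0"
  shows "0 \<le> k $ j" "int n \<le> total_degree k"
  using assms by (auto simp: order_ge_def)

lemma total_degree_nonneg: "(\<And>j. 0 \<le> k $ j) \<Longrightarrow> 0 \<le> total_degree k"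
  by (simp add: total_degree_def sum_nonneg)

lemma total_degree_add: "total_degree (k + l) = total_degree k + total_degree l"
  by (simp add: total_degree_def sum.distrib)

lemma total_degree_diff: "total_degree (k - l) = total_degree k - total_degree l"
  by (simp add: total_degree_def sum_subtractf)

lemma total_degree_axis [simp]: "total_degree (axis s 1) = 1"
  by (simp add: total_degree_def axis_def)

lemma component_le_total_degree:
  assumes "\<And>j. 0 \<le> k $ j"
  shows "k $ j \<le> total_degree k"
  unfolding total_degree_def using assms by (intro member_le_sum) auto

lemma total_degree_pos:
  assumes "\<And>j. 0 \<le> k $ j" "k \<noteq> 0"
  shows "1 \<le> total_degree k"
proof -
  obtain j where "k $ j \<noteq> 0" using assms(2) by (auto simp: vec_eq_iff)
  then show ?thesis using component_le_total_degree[of k j, OF assms(1)] assms(1)[of j] by linarith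
qed

lemma order_ge_0: "order_ge 0 f \<longleftrightarrow> power_series f"
  by (auto simp: order_ge_def power_series_def intro: total_degree_nonneg)

lemma order_ge_mono: "order_ge n f \<Longrightarrow> m \<le> n \<Longrightarrow> order_ge m f"
  by (force simp: order_ge_def)

lemma order_ge_power_series: "order_ge n f \<Longrightarrow> power_series f"
  using order_ge_mono order_ge_0 by blast

lemma order_ge_1: "order_ge 1 f \<longleftrightarrow> power_series f \<and> mcoeff f 0 = 0"
proof
  assume "order_ge 1 f"
  then show "power_series f \<and> mcoeff f 0 = 0"
    using order_geD(2)[of 1 f 0] by (auto simp: order_ge_power_series total_degree_def)
next
  assume f: "power_series f \<and> mcoeff f 0 = 0"
  show "order_ge 1 f"
    unfolding order_ge_def
  proof (intro allI impI conjI)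
    fix k assume k: "mcoeff f k \<noteq> 0"
    then have nonneg: "0 \<le> k $ j" for j using f by (auto simp: power_series_def)
    then show "0 \<le> k $ j" for j .
    have "k \<noteq> 0" using k f by auto
    then show "int 1 \<le> total_degree k" using total_degree_pos[OF nonneg] by simp
  qed
qed

lemma order_ge_all_imp_0:
  assumes "\<And>n. order_ge n f"
  shows "f = 0"
proof (rule mlaurent_eqI)
  fix k
  show "mcoeff f k = mcoeff 0 k"
  proof (rule ccontr)
    assume k: "mcoeff f k \<noteq> mcoeff 0 k"
    then have "0 \<le> k $ j" for j
      using assms by (intro order_geD(1)[of 0 f]) (auto simp: mcoeff_simps)
    then have "0 \<le> total_degree k" by (rule total_degree_nonneg)
    moreover from k have "int (Suc (nat (total_degree k))) \<le> total_degree k"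
      using assms by (intro order_geD) (auto simp: mcoeff_simps)
    ultimately show False by linarith
  qed
qed

lemma order_ge_zero [simp]: "order_ge n 0"
  by (simp add: order_ge_def mcoeff_simps)

lemma order_ge_add: "order_ge n f \<Longrightarrow> order_ge n g \<Longrightarrow> order_ge n (f + g)"
  unfolding order_ge_def by (metis add.right_neutral add_0 plus_mlaurent.rep_eq)

lemma order_ge_minus: "order_ge n f \<Longrightarrow> order_ge n (- f)"
  by (simp add: order_ge_def mcoeff_simps)

lemma order_ge_diff: "order_ge n f \<Longrightarrow> order_ge n g \<Longrightarrow> order_ge n (f - g)"
  using order_ge_add[of n f "- g"] by (simp add: order_ge_minus)

lemma order_ge_sum: "(\<And>a. a \<in> A \<Longrightarrow> order_ge n (f a)) \<Longrightarrow> order_ge n (sum f A)"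
  by (induction A rule: infinite_finite_induct) (auto intro: order_ge_add)

lemma order_ge_mult:
  assumes "order_ge m f" "order_ge n g"
  shows "order_ge (m + n) (f * g)"
  unfolding order_ge_def
proof (intro allI impI)
  fix k assume "mcoeff (f * g) k \<noteq> 0"
  then obtain l where l: "mcoeff f l \<noteq> 0" "mcoeff g (k - l) \<noteq> 0" by (rule mcoeff_mult_nonzeroE)
  have "0 \<le> k $ j" for j
    using order_geD(1)[OF assms(1) l(1), of j] order_geD(1)[OF assms(2) l(2), of j] by simp
  moreover have "int (m + n) \<le> total_degree k"
    using order_geD(2)[OF assms(1) l(1)] order_geD(2)[OF assms(2) l(2)]
    by (simp add: total_degree_diff)
  ultimately show "(\<forall>j. 0 \<le> k $ j) \<and> int (m + n) \<le> total_degree k" by blast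
qed

lemma order_ge_mult_left: "power_series f \<Longrightarrow> order_ge n g \<Longrightarrow> order_ge n (f * g)"
  using order_ge_mult[of 0 f n g] by (simp add: order_ge_0)

lemma power_series_mconst [simp]: "power_series (mconst c)"
  by (simp add: power_series_def mconst.rep_eq)

lemma order_ge_mconst_mult: "order_ge n g \<Longrightarrow> order_ge n (mconst c * g)"
  by (simp add: order_ge_mult_left)

lemma power_series_0 [simp]: "power_series 0"
  and power_series_1 [simp]: "power_series 1"
  using power_series_mconst[of 0] power_series_mconst[of 1] by simp_all

lemma power_series_add: "power_series f \<Longrightarrow> power_series g \<Longrightarrow> power_series (f + g)"
  and power_series_diff: "power_series f \<Longrightarrow> power_series g \<Longrightarrow> power_series (f - g)"
  and power_series_minus: "power_series f \<Longrightarrow> power_series (- f)"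
  and power_series_mult: "power_series f \<Longrightarrow> power_series g \<Longrightarrow> power_series (f * g)"
  using order_ge_add[of 0] order_ge_diff[of 0] order_ge_minus[of 0] order_ge_mult[of 0 f 0 g]
  by (auto simp: order_ge_0)

lemma power_series_sum: "(\<And>a. a \<in> A \<Longrightarrow> power_series (f a)) \<Longrightarrow> power_series (sum f A)"
  using order_ge_sum[of A 0 f] by (simp add: order_ge_0)

lemma order_ge_power: "order_ge m f \<Longrightarrow> order_ge (n * m) (f ^ n)"
  by (induction n) (auto simp: order_ge_0 intro: order_ge_mult)

lemma order_ge_prod:
  "(\<And>a. a \<in> A \<Longrightarrow> order_ge (n a) (f a)) \<Longrightarrow> order_ge (sum n A) (prod f A)"
  by (induction A rule: infinite_finite_induct) (auto simp: order_ge_0 intro: order_ge_mult)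

lemma power_series_power: "power_series f \<Longrightarrow> power_series (f ^ n)"
  using order_ge_power[of 0 f n] by (simp add: order_ge_0)

lemma power_series_prod: "(\<And>a. a \<in> A \<Longrightarrow> power_series (f a)) \<Longrightarrow> power_series (prod f A)"
  using order_ge_prod[of A "\<lambda>_. 0" f] by (simp add: order_ge_0)

lemma order_ge_mmonom:
  "(\<And>j. 0 \<le> k $ j) \<Longrightarrow> int n \<le> total_degree k \<Longrightarrow> order_ge n (mmonom k)"
  by (simp add: order_ge_def mmonom.rep_eq)

lemma order_ge_mvar: "order_ge 1 (mvar j)"
  unfolding mvar_def by (rule order_ge_mmonom) (auto simp: axis_def[of _ 1] total_degree_def)

lemma power_series_mvar [simp]: "power_series (mvar j)"
  using order_ge_mvar by (rule order_ge_power_series)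

lemma order_ge_mderiv:
  assumes "order_ge (Suc n) f"
  shows "order_ge n (mderiv s f)"
  unfolding order_ge_def
proof (intro allI impI)
  fix k assume "mcoeff (mderiv s f) k \<noteq> 0"
  then have k: "k $ s + 1 \<noteq> 0" "mcoeff f (k + axis s 1) \<noteq> 0"
    by (auto simp: mderiv.rep_eq)
  have *: "0 \<le> (k + axis s 1) $ j" for j using order_geD(1)[OF assms k(2)] .
  have "0 \<le> k $ j" for j
    using *[of j] k(1) by (cases "j = s") (auto simp: axis_def)
  then show "(\<forall>j. 0 \<le> k $ j) \<and> int n \<le> total_degree k"
    using order_geD(2)[OF assms k(2)] by (simp add: total_degree_add)
qed

lemma power_series_mderiv:
  assumes "power_series f"
  shows "power_series (mderiv s f)"
proof -
  have "mderiv s f = mderiv s (f - mconst (mcoeff f 0))" by (simp add: mderiv_diff)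
  moreover have "order_ge 1 (f - mconst (mcoeff f 0))"
    unfolding order_ge_1 using assms by (simp add: power_series_diff mcoeff_diff)
  ultimately show ?thesis using order_ge_mderiv order_ge_0 One_nat_def by metis
qed

lemma order_ge_mrename:
  fixes \<iota> :: "'v::finite \<Rightarrow> 'w::finite"
  assumes "inj \<iota>" "order_ge n f"
  shows "order_ge n (mrename \<iota> f)"
  unfolding order_ge_def
proof (intro allI impI)
  fix m assume "mcoeff (mrename \<iota> f) m \<noteq> 0"
  then obtain k where k: "m = extend_exponent \<iota> k" "mcoeff f k \<noteq> 0"
    by (rule mcoeff_mrename_nonzeroE[OF assms(1)])
  have "total_degree m = (\<Sum>t\<in>range \<iota>. m $ t)"
    unfolding total_degree_def
    by (rule sum.mono_neutral_right) (auto simp: k extend_exponent_nth[OF assms(1)])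
  also have "\<dots> = total_degree k"
    by (simp add: sum.reindex[OF assms(1)] total_degree_def k extend_exponent_nth[OF assms(1)])
  finally have "int n \<le> total_degree m" using order_geD(2)[OF assms(2) k(2)] by simp
  moreover have "0 \<le> m $ t" for t
    using order_geD(1)[OF assms(2) k(2)] by (simp add: k extend_exponent_def)
  ultimately show "(\<forall>j. 0 \<le> m $ j) \<and> int n \<le> total_degree m" by blast
qed

lemma power_series_mrename: "inj \<iota> \<Longrightarrow> power_series f \<Longrightarrow> power_series (mrename \<iota> f)"
  using order_ge_mrename[of \<iota> 0 f] by (simp add: order_ge_0)

lemma mcoeff_mult_0:
  assumes "power_series f" "power_series g"
  shows "mcoeff (f * g) 0 = mcoeff f 0 * mcoeff g 0"
proof -
  have "mcoeff (f * g) 0 = (\<Sum>l\<in>{0}. mcoeff f l * mcoeff g (0 - l))"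
  proof (rule mcoeff_mult_superset)
    fix l assume "mcoeff f l \<noteq> 0" "mcoeff g (0 - l) \<noteq> 0"
    then have "0 \<le> l $ j" "0 \<le> (0 - l) $ j" for j
      using assms unfolding power_series_def by blast+
    then have "l $ j = 0" for j
      by (metis antisym diff_0 neg_0_le_iff_le vector_minus_component zero_index)
    then show "l \<in> {0}" by (simp add: vec_eq_iff)
  qed simp
  then show ?thesis by simp
qed

text \<open>
  The linear maps on power series that lower the order by at most \<open>d\<close>. They are continuous for
  the topology defined by the order, hence determined by their values on monomials.
\<close>

definition filtered_linear :: "nat \<Rightarrow> ('v::finite mlaurent \<Rightarrow> 'w::finite mlaurent) \<Rightarrow> bool"
  where "filtered_linear d \<Phi> \<longleftrightarrow>
    (\<forall>f g. power_series f \<longrightarrow> power_series g \<longrightarrow> \<Phi> (f + g) = \<Phi> f + \<Phi> g) \<and>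
    (\<forall>c f. power_series f \<longrightarrow> \<Phi> (mconst c * f) = mconst c * \<Phi> f) \<and>
    (\<forall>n f. order_ge (n + d) f \<longrightarrow> order_ge n (\<Phi> f))"

lemma filtered_linearI:
  assumes "\<And>f g. power_series f \<Longrightarrow> power_series g \<Longrightarrow> \<Phi> (f + g) = \<Phi> f + \<Phi> g"
    "\<And>c f. power_series f \<Longrightarrow> \<Phi> (mconst c * f) = mconst c * \<Phi> f"
    "\<And>n f. order_ge (n + d) f \<Longrightarrow> order_ge n (\<Phi> f)"
  shows "filtered_linear d \<Phi>"
  using assms by (auto simp: filtered_linear_def)

lemma filtered_linearD:
  assumes "filtered_linear d \<Phi>"
  shows "power_series f \<Longrightarrow> power_series g \<Longrightarrow> \<Phi> (f + g) = \<Phi> f + \<Phi> g"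
    "power_series f \<Longrightarrow> \<Phi> (mconst c * f) = mconst c * \<Phi> f"
    "order_ge (n + d) f \<Longrightarrow> order_ge n (\<Phi> f)"
  using assms by (auto simp: filtered_linear_def)

lemma filtered_linear_0:
  assumes "filtered_linear d \<Phi>"
  shows "\<Phi> 0 = 0"
  using filtered_linearD(2)[OF assms, of 0 0] by simp

lemma filtered_linear_sum:
  assumes "filtered_linear d \<Phi>" "\<And>a. a \<in> A \<Longrightarrow> power_series (f a)"
  shows "\<Phi> (sum f A) = (\<Sum>a\<in>A. \<Phi> (f a))"
  using assms(2)
  by (induction A rule: infinite_finite_induct)
    (auto simp: filtered_linear_0[OF assms(1)] filtered_linearD(1)[OF assms(1)] power_series_sum)

lemma filtered_linear_diff:
  assumes "filtered_linear d \<Phi>" "filtered_linear d \<Psi>"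
  shows "filtered_linear d (\<lambda>f. \<Phi> f - \<Psi> f)"
proof (rule filtered_linearI)
  note D = filtered_linearD[OF assms(1)] filtered_linearD[OF assms(2)]
  show "\<Phi> (f + g) - \<Psi> (f + g) = (\<Phi> f - \<Psi> f) + (\<Phi> g - \<Psi> g)"
    if "power_series f" "power_series g" for f g
    using that by (simp add: D)
  show "\<Phi> (mconst c * f) - \<Psi> (mconst c * f) = mconst c * (\<Phi> f - \<Psi> f)"
    if "power_series f" for c f
    using that by (simp add: D right_diff_distrib)
  show "order_ge n (\<Phi> f - \<Psi> f)" if "order_ge (n + d) f" for n f
    using that by (intro order_ge_diff D)
qed

lemma filtered_linear_comp:
  assumes "filtered_linear 0 \<Phi>" "filtered_linear d \<Psi>"
  shows "filtered_linear d (\<lambda>f. \<Psi> (\<Phi> f))"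
proof (rule filtered_linearI)
  have ps: "power_series (\<Phi> f)" if "power_series f" for f
    using filtered_linearD(3)[OF assms(1), of 0 f] that by (simp add: order_ge_0)
  show "\<Psi> (\<Phi> (f + g)) = \<Psi> (\<Phi> f) + \<Psi> (\<Phi> g)" if "power_series f" "power_series g" for f g
    using that assms by (simp add: filtered_linearD(1) ps)
  show "\<Psi> (\<Phi> (mconst c * f)) = mconst c * \<Psi> (\<Phi> f)" if "power_series f" for c f
    using that by (simp add: filtered_linearD(2)[OF assms(1)] filtered_linearD(2)[OF assms(2)] ps)
  show "order_ge n (\<Psi> (\<Phi> f))" if "order_ge (n + d) f" for n f
    using that assms filtered_linearD(3)[OF assms(1), of "n + d" f]
    by (auto intro: filtered_linearD(3))
qed

lemma filtered_linear_id: "filtered_linear 0 (\<lambda>f. f)"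
  by (auto intro: filtered_linearI)

lemma filtered_linear_mult:
  assumes "filtered_linear d \<Phi>" "power_series g"
  shows "filtered_linear d (\<lambda>f. g * \<Phi> f)"
proof (rule filtered_linearI)
  note D = filtered_linearD[OF assms(1)]
  show "g * \<Phi> (f + h) = g * \<Phi> f + g * \<Phi> h" if "power_series f" "power_series h" for f h
    using that by (simp add: D distrib_left)
  show "g * \<Phi> (mconst c * f) = mconst c * (g * \<Phi> f)" if "power_series f" for c f
    using that by (simp add: D mult.left_commute)
  show "order_ge n (g * \<Phi> f)" if "order_ge (n + d) f" for n f
    using that by (intro order_ge_mult_left assms(2) D)
qed

lemma filtered_linear_sum_fun:
  assumes "\<And>a. a \<in> A \<Longrightarrow> filtered_linear d (\<Phi> a)"
  shows "filtered_linear d (\<lambda>f. \<Sum>a\<in>A. \<Phi> a f)"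
proof (rule filtered_linearI)
  note D = filtered_linearD[OF assms]
  show "(\<Sum>a\<in>A. \<Phi> a (f + h)) = (\<Sum>a\<in>A. \<Phi> a f) + (\<Sum>a\<in>A. \<Phi> a h)"
    if "power_series f" "power_series h" for f h
    using that by (simp add: D sum.distrib cong: sum.cong)
  show "(\<Sum>a\<in>A. \<Phi> a (mconst c * f)) = mconst c * (\<Sum>a\<in>A. \<Phi> a f)" if "power_series f" for c f
    using that by (simp add: D sum_distrib_left cong: sum.cong)
  show "order_ge n (\<Sum>a\<in>A. \<Phi> a f)" if "order_ge (n + d) f" for n f
    using that by (intro order_ge_sum D)
qed

lemma filtered_linear_mderiv: "filtered_linear 1 (mderiv s)"
  by (intro filtered_linearI) (auto simp: mderiv_add mderiv_mult intro: order_ge_mderiv)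

lemma filtered_linear_mrename: "inj \<iota> \<Longrightarrow> filtered_linear 0 (mrename \<iota>)"
  by (intro filtered_linearI) (auto simp: mrename_add mrename_mult intro: order_ge_mrename)

text \<open>
  Up to terms of high order, a power series is a finite linear combination of monomials.
\<close>

lemma filtered_linear_order_ge:
  assumes \<Phi>: "filtered_linear d \<Phi>" and f: "order_ge r f"
    and monom: "\<And>k. (\<And>j. 0 \<le> k $ j) \<Longrightarrow> int r \<le> total_degree k \<Longrightarrow> order_ge n (\<Phi> (mmonom k))"
  shows "order_ge n (\<Phi> f)"
proof -
  define S where "S = {k. mcoeff f k \<noteq> 0 \<and> total_degree k < int (n + d)}"
  define p where "p = (\<Sum>k\<in>S. mconst (mcoeff f k) * mmonom k)"
  have "S \<subseteq> {k. \<forall>j. 0 \<le> k $ j \<and> k $ j \<le> int (n + d)}"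
  proof
    fix k assume k: "k \<in> S"
    then have nonneg: "0 \<le> k $ j" for j using order_geD(1)[OF f] by (auto simp: S_def)
    then have "k $ j \<le> int (n + d)" for j
      using component_le_total_degree[OF nonneg, of j] k by (simp add: S_def)
    then show "k \<in> {k. \<forall>j. 0 \<le> k $ j \<and> k $ j \<le> int (n + d)}" using nonneg by simp
  qed
  then have S: "finite S" by (rule finite_subset) (rule finite_vec_box)
  have ps: "power_series (mconst (mcoeff f k) * mmonom k)" if "k \<in> S" for k
    using that order_geD[OF f, of k]
    by (intro power_series_mult power_series_mconst order_ge_power_series[of 0] order_ge_mmonom)
      (auto simp: S_def)
  have "mcoeff p m = (if m \<in> S then mcoeff f m else 0)" for m
    using S by (simp add: p_def mcoeff_sum mcoeff_mconst_mult mmonom.rep_eq if_distrib cong: if_cong)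
  then have "order_ge (n + d) (f - p)"
    using order_geD[OF f] by (auto simp: order_ge_def mcoeff_diff S_def split: if_splits)
  then have rest: "order_ge n (\<Phi> (f - p))" by (rule filtered_linearD(3)[OF \<Phi>])
  have "order_ge n (\<Phi> (mconst (mcoeff f k) * mmonom k))" if "k \<in> S" for k
  proof -
    have k: "mcoeff f k \<noteq> 0" using that by (simp add: S_def)
    have "power_series (mmonom k)"
      using order_geD[OF f k] by (intro order_ge_power_series[of 0] order_ge_mmonom) auto
    then show ?thesis
      using order_geD[OF f k] by (simp add: filtered_linearD(2)[OF \<Phi>] order_ge_mconst_mult monom)
  qed
  then have "order_ge n (\<Phi> p)"
    unfolding p_def using ps by (simp add: filtered_linear_sum[OF \<Phi>] order_ge_sum)
  moreover have "\<Phi> f = \<Phi> p + \<Phi> (f - p)"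
    using filtered_linearD(1)[OF \<Phi>, of p "f - p"] ps f
    by (simp add: p_def power_series_sum power_series_diff order_ge_power_series)
  ultimately show ?thesis using rest by (simp add: order_ge_add)
qed

lemma mmonom_induct [consumes 1, case_names one mult]:
  assumes "\<And>j. 0 \<le> k $ j"
    and "P 1" and step: "\<And>j k. (\<And>i. 0 \<le> k $ i) \<Longrightarrow> P (mmonom k) \<Longrightarrow> P (mvar j * mmonom k)"
  shows "P (mmonom k)"
  using assms(1)
proof (induction "nat (total_degree k)" arbitrary: k)
  case 0
  then have "k = 0" using total_degree_pos[of k] by force
  then show ?case using assms(2) by (simp add: mmonom_0)
next
  case (Suc n)
  then have "k \<noteq> 0" by (auto simp: total_degree_def)
  then obtain j where j: "k $ j \<noteq> 0" by (auto simp: vec_eq_iff)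
  define l where "l = k - axis j 1"
  have nonneg: "0 \<le> l $ i" for i
    using Suc.prems[of i] j by (cases "i = j") (auto simp: l_def axis_def)
  have "n = nat (total_degree l)" using Suc.hyps(2) by (simp add: l_def total_degree_diff)
  then have "P (mmonom l)" using nonneg by (rule Suc.hyps(1))
  then have "P (mvar j * mmonom l)" by (rule step[OF nonneg])
  moreover have "mvar j * mmonom l = mmonom k" by (simp add: mvar_def mmonom_mult l_def)
  ultimately show ?case by simp
qed

lemma filtered_linear_eq_monomialsI:
  assumes "filtered_linear d \<Phi>" "filtered_linear d \<Psi>" "power_series f"
    and "\<And>k. (\<And>j. 0 \<le> k $ j) \<Longrightarrow> \<Phi> (mmonom k) = \<Psi> (mmonom k)"
  shows "\<Phi> f = \<Psi> f"
proof -
  have "order_ge n (\<Phi> f - \<Psi> f)" for n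
    by (rule filtered_linear_order_ge[OF filtered_linear_diff[OF assms(1,2)], of 0])
      (use assms(3,4) in \<open>auto simp: order_ge_0\<close>)
  then show ?thesis using order_ge_all_imp_0[of "\<Phi> f - \<Psi> f"] by simp
qed

text \<open>
  The identities for substitution below all follow from this principle: two such maps agree as soon
  as they agree at \<open>1\<close> and agreement is preserved under multiplication by a variable.
\<close>

lemma filtered_linear_eqI:
  assumes "filtered_linear d \<Phi>" "filtered_linear d \<Psi>" "power_series f" "\<Phi> 1 = \<Psi> 1"
    and "\<And>j g. power_series g \<Longrightarrow> \<Phi> g = \<Psi> g \<Longrightarrow> \<Phi> (mvar j * g) = \<Psi> (mvar j * g)"
  shows "\<Phi> f = \<Psi> f"
proof (rule filtered_linear_eq_monomialsI[OF assms(1-3)])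
  fix k :: "int ^ 'a" assume nonneg: "\<And>j. 0 \<le> k $ j"
  then show "\<Phi> (mmonom k) = \<Psi> (mmonom k)"
  proof (induction rule: mmonom_induct)
    case (mult j k)
    then show ?case
      by (intro assms(5) order_ge_power_series[of 0] order_ge_mmonom)
        (simp_all add: total_degree_nonneg)
  qed (use assms in simp)
qed

section \<open>Substitution\<close>

lemma order_ge_monomial_subst:
  assumes "\<And>j. order_ge 1 (Y j)" "\<And>j. 0 \<le> k $ j"
  shows "order_ge (nat (total_degree k)) (\<Prod>j\<in>UNIV. Y j ^ nat (k $ j))"
proof -
  have "nat (total_degree k) = (\<Sum>j\<in>UNIV. nat (k $ j) * 1)"
  proof -
    have "int (\<Sum>j\<in>UNIV. nat (k $ j)) = total_degree k"
      using assms(2) by (simp add: total_degree_def)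
    from this[symmetric] show ?thesis by (simp only: nat_int mult_1_right)
  qed
  then show ?thesis using assms(1) by (simp only:) (intro order_ge_prod order_ge_power)
qed

text \<open>
  If the \<open>Y\<^sub>j\<close> have no constant term, then only the coefficients of \<open>f\<close> of total degree at most
  that of \<open>m\<close> contribute to the coefficient at \<open>m\<close> of the substitution.
\<close>

lemma mcoeff_msubst:
  fixes Y :: "'v::finite \<Rightarrow> 'w::finite mlaurent"
  assumes f: "power_series f" and Y: "\<And>j. order_ge 1 (Y j)"
    and S: "finite S" "\<And>k. mcoeff f k \<noteq> 0 \<Longrightarrow> total_degree k \<le> total_degree m \<Longrightarrow> k \<in> S"
  shows "mcoeff (msubst f Y) m
    = (\<Sum>k\<in>S. mcoeff f k * mcoeff (\<Prod>j\<in>UNIV. Y j ^ nat (k $ j)) m)"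
proof -
  define c where "c = (\<lambda>m k. mcoeff f k * mcoeff (\<Prod>j\<in>UNIV. Y j ^ nat (k $ j)) m)"
  have c: "(\<forall>j. 0 \<le> m $ j) \<and> mcoeff f k \<noteq> 0 \<and> total_degree k \<le> total_degree m"
    if "c m k \<noteq> 0" for m k
  proof -
    have k: "mcoeff f k \<noteq> 0" and m: "mcoeff (\<Prod>j\<in>UNIV. Y j ^ nat (k $ j)) m \<noteq> 0"
      using that by (auto simp: c_def)
    have "0 \<le> k $ j" for j using f k by (auto simp: power_series_def)
    note * = order_ge_monomial_subst[OF Y this]
    have "total_degree k \<le> total_degree m" using order_geD(2)[OF * m] by linarith
    then show ?thesis using order_geD(1)[OF * m] k by blast
  qed
  have "(\<lambda>m. \<Sum>k | c m k \<noteq> 0. c m k) \<in> {f. \<exists>N. \<forall>k j. f k \<noteq> 0 \<longrightarrow> N \<le> k $ j}"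
  proof (simp, intro exI allI impI)
    fix m :: "int ^ 'w" and j assume "(\<Sum>k | c m k \<noteq> 0. c m k) \<noteq> 0"
    then obtain k where "c m k \<noteq> 0" by (rule sum.not_neutral_contains_not_neutral)
    then show "0 \<le> m $ j" using c by blast
  qed
  then have "mcoeff (msubst f Y) m = (\<Sum>k | c m k \<noteq> 0. c m k)"
    by (simp add: msubst_def Abs_mlaurent_inverse Let_def c_def)
  also have "\<dots> = (\<Sum>k\<in>S. c m k)"
    by (rule sum.mono_neutral_left) (use S c in auto)
  finally show ?thesis by (simp add: c_def)
qed

lemma finite_exponents_degree_le:
  "finite {k :: int ^ 'v::finite. (\<forall>j. 0 \<le> k $ j) \<and> total_degree k \<le> d}"
proof (rule finite_subset)
  show "{k :: int ^ 'v. (\<forall>j. 0 \<le> k $ j) \<and> total_degree k \<le> d}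
      \<subseteq> {k. \<forall>j. 0 \<le> k $ j \<and> k $ j \<le> d}"
    using component_le_total_degree by (auto intro: order_trans)
qed (rule finite_vec_box)

lemma filtered_linear_msubst:
  fixes Y :: "'v::finite \<Rightarrow> 'w::finite mlaurent"
  assumes Y: "\<And>j. order_ge 1 (Y j)"
  shows "filtered_linear 0 (\<lambda>f. msubst f Y)"
proof -
  define S where
    "S = (\<lambda>m :: int ^ 'w. {k :: int ^ 'v. (\<forall>j. 0 \<le> k $ j) \<and> total_degree k \<le> total_degree m})"
  have coeff: "mcoeff (msubst f Y) m
    = (\<Sum>k\<in>S m. mcoeff f k * mcoeff (\<Prod>j\<in>UNIV. Y j ^ nat (k $ j)) m)" if "power_series f" for f m
    using that Y finite_exponents_degree_le
    by (intro mcoeff_msubst) (auto simp: S_def power_series_def)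
  show ?thesis
  proof (rule filtered_linearI)
    fix f g :: "'v mlaurent" and c :: real
    assume f: "power_series f"
    then show "msubst (mconst c * f) Y = mconst c * msubst f Y"
      by (intro mlaurent_eqI)
        (simp add: coeff power_series_mult mcoeff_mconst_mult sum_distrib_left mult.assoc)
    assume "power_series g"
    with f show "msubst (f + g) Y = msubst f Y + msubst g Y"
      by (intro mlaurent_eqI)
        (simp add: coeff power_series_add plus_mlaurent.rep_eq sum.distrib distrib_right)
  next
    fix n and f :: "'v mlaurent" assume "order_ge (n + 0) f"
    then have f: "order_ge n f" by simp
    show "order_ge n (msubst f Y)"
      unfolding order_ge_def
    proof (intro allI impI)
      fix m assume "mcoeff (msubst f Y) m \<noteq> 0"
      then obtain k where "k \<in> S m" and "mcoeff f k * mcoeff (\<Prod>j\<in>UNIV. Y j ^ nat (k $ j)) m \<noteq> 0"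
        unfolding coeff[OF order_ge_power_series[OF f]] by (rule sum.not_neutral_contains_not_neutral)
      then have nonneg: "0 \<le> k $ j" and k: "mcoeff f k \<noteq> 0"
        and m: "mcoeff (\<Prod>j\<in>UNIV. Y j ^ nat (k $ j)) m \<noteq> 0" for j
        by (auto simp: S_def)
      note * = order_ge_monomial_subst[OF Y nonneg]
      have "int n \<le> total_degree m"
        using order_geD(2)[OF * m] order_geD(2)[OF f k] by linarith
      then show "(\<forall>j. 0 \<le> m $ j) \<and> int n \<le> total_degree m"
        using order_geD(1)[OF * m] by blast
    qed
  qed
qed

lemma msubst_mmonom:
  assumes "\<And>j. order_ge 1 (Y j)" "\<And>j. 0 \<le> k $ j"
  shows "msubst (mmonom k) Y = (\<Prod>j\<in>UNIV. Y j ^ nat (k $ j))"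
proof (rule mlaurent_eqI)
  have "power_series (mmonom k)"
    using assms(2) by (auto simp: power_series_def mmonom.rep_eq)
  then show "mcoeff (msubst (mmonom k) Y) m = mcoeff (\<Prod>j\<in>UNIV. Y j ^ nat (k $ j)) m" for m
    by (subst mcoeff_msubst[where S = "{k}"])
      (use assms(1) in \<open>auto simp: mmonom.rep_eq split: if_splits\<close>)
qed

lemma msubst_1: "(\<And>j. order_ge 1 (Y j)) \<Longrightarrow> msubst 1 Y = 1"
  using msubst_mmonom[of Y 0] by (simp add: mmonom_0)

lemma msubst_mvar:
  assumes "\<And>j. order_ge 1 (Y j)"
  shows "msubst (mvar j) Y = Y j"
proof -
  have "(\<Prod>i\<in>UNIV. Y i ^ nat (axis j 1 $ i)) = (\<Prod>i\<in>UNIV. if i = j then Y i else 1)"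
    by (rule prod.cong) (auto simp: axis_def)
  then show ?thesis using assms by (simp add: mvar_def msubst_mmonom axis_def)
qed

context
  fixes Y :: "'v::finite \<Rightarrow> 'w::finite mlaurent"
  assumes Y: "\<And>j. order_ge 1 (Y j)"
begin

lemma msubst_add: "power_series f \<Longrightarrow> power_series g \<Longrightarrow> msubst (f + g) Y = msubst f Y + msubst g Y"
  by (rule filtered_linearD(1)[OF filtered_linear_msubst[OF Y]])

lemma msubst_mconst_mult: "power_series f \<Longrightarrow> msubst (mconst c * f) Y = mconst c * msubst f Y"
  by (rule filtered_linearD(2)[OF filtered_linear_msubst[OF Y]])

lemma msubst_mconst: "msubst (mconst c) Y = mconst c"
  using msubst_mconst_mult[of 1 c] by (simp add: msubst_1[OF Y])

lemma msubst_0: "msubst 0 Y = 0"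
  using msubst_mconst[of 0] by simp

lemma msubst_minus: "power_series f \<Longrightarrow> msubst (- f) Y = - msubst f Y"
  using msubst_mconst_mult[of f "- 1"] by (simp add: mconst_minus)

lemma msubst_diff: "power_series f \<Longrightarrow> power_series g \<Longrightarrow> msubst (f - g) Y = msubst f Y - msubst g Y"
  using msubst_add[of f "- g"] by (simp add: msubst_minus power_series_minus)

lemma msubst_sum:
  "(\<And>a. a \<in> A \<Longrightarrow> power_series (f a)) \<Longrightarrow> msubst (sum f A) Y = (\<Sum>a\<in>A. msubst (f a) Y)"
  by (rule filtered_linear_sum[OF filtered_linear_msubst[OF Y]])

lemma order_ge_msubst: "order_ge n f \<Longrightarrow> order_ge n (msubst f Y)"
  using filtered_linearD(3)[OF filtered_linear_msubst[OF Y], of n f] by simp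

lemma power_series_msubst: "power_series f \<Longrightarrow> power_series (msubst f Y)"
  using order_ge_msubst[of 0 f] by (simp add: order_ge_0)

lemma msubst_mvar_mult:
  assumes "power_series f"
  shows "msubst (mvar j * f) Y = Y j * msubst f Y"
proof -
  note FL = filtered_linear_msubst[OF Y]
  have L: "filtered_linear 0 (\<lambda>f. msubst (mvar j * f) Y)"
    by (rule filtered_linear_comp[OF filtered_linear_mult[OF filtered_linear_id power_series_mvar] FL])
  have R: "filtered_linear 0 (\<lambda>f. Y j * msubst f Y)"
    by (rule filtered_linear_mult[OF FL order_ge_power_series[OF Y]])
  show ?thesis
  proof (rule filtered_linear_eq_monomialsI[OF L R assms])
    fix k :: "int ^ 'v" assume k: "\<And>i. 0 \<le> k $ i"
    have "msubst (mvar j * mmonom k) Y = (\<Prod>i\<in>UNIV. Y i ^ nat ((axis j 1 + k) $ i))"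
      unfolding mvar_def mmonom_mult by (rule msubst_mmonom[OF Y]) (simp add: k axis_def)
    also have "\<dots> = (\<Prod>i\<in>UNIV. (if i = j then Y i else 1) * Y i ^ nat (k $ i))"
      by (rule prod.cong) (auto simp: axis_def k nat_add_distrib)
    also have "\<dots> = Y j * msubst (mmonom k) Y"
      by (simp add: prod.distrib msubst_mmonom[OF Y k])
    finally show "msubst (mvar j * mmonom k) Y = Y j * msubst (mmonom k) Y" .
  qed
qed

lemma msubst_mult:
  assumes "power_series f" "power_series g"
  shows "msubst (f * g) Y = msubst f Y * msubst g Y"
proof -
  note FL = filtered_linear_msubst[OF Y]
  have L: "filtered_linear 0 (\<lambda>f. msubst (g * f) Y)"
    by (rule filtered_linear_comp[OF filtered_linear_mult[OF filtered_linear_id assms(2)] FL])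
  have R: "filtered_linear 0 (\<lambda>f. msubst g Y * msubst f Y)"
    by (rule filtered_linear_mult[OF FL power_series_msubst[OF assms(2)]])
  have "msubst (g * f) Y = msubst g Y * msubst f Y"
  proof (rule filtered_linear_eqI[OF L R assms(1)])
    show "msubst (g * 1) Y = msubst g Y * msubst 1 Y" by (simp add: msubst_1[OF Y])
  next
    fix j f assume "power_series f" "msubst (g * f) Y = msubst g Y * msubst f Y"
    then show "msubst (g * (mvar j * f)) Y = msubst g Y * msubst (mvar j * f) Y"
      using assms(2) by (simp add: msubst_mvar_mult power_series_mult mult.left_commute[of g])
  qed
  then show ?thesis by (simp add: mult.commute)
qed

lemma msubst_power: "power_series f \<Longrightarrow> msubst (f ^ n) Y = msubst f Y ^ n"
  by (induction n) (simp_all add: msubst_1[OF Y] msubst_mult power_series_power)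

lemma msubst_prod:
  "(\<And>a. a \<in> A \<Longrightarrow> power_series (f a)) \<Longrightarrow> msubst (prod f A) Y = (\<Prod>a\<in>A. msubst (f a) Y)"
  by (induction A rule: infinite_finite_induct)
    (simp_all add: msubst_1[OF Y] msubst_mult power_series_prod)

end

lemma msubst_msubst:
  assumes Y: "\<And>j. order_ge 1 (Y j)" and Z: "\<And>i. order_ge 1 (Z i)" and "power_series f"
  shows "msubst (msubst f Y) Z = msubst f (\<lambda>j. msubst (Y j) Z)"
proof -
  have YZ: "order_ge 1 (msubst (Y j) Z)" for j
    by (rule order_ge_msubst[OF Z Y])
  have L: "filtered_linear 0 (\<lambda>f. msubst (msubst f Y) Z)"
    by (rule filtered_linear_comp[OF filtered_linear_msubst[OF Y] filtered_linear_msubst[OF Z]])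
  show ?thesis
  proof (rule filtered_linear_eqI[OF L filtered_linear_msubst[OF YZ] assms(3)])
    fix j f assume "power_series f" "msubst (msubst f Y) Z = msubst f (\<lambda>j. msubst (Y j) Z)"
    then show "msubst (msubst (mvar j * f) Y) Z = msubst (mvar j * f) (\<lambda>j. msubst (Y j) Z)"
      using order_ge_power_series[OF Y]
      by (simp add: msubst_mvar_mult[OF Y] msubst_mvar_mult[OF YZ] msubst_mult[OF Z]
          power_series_msubst[OF Y])
  qed (simp add: msubst_1[OF Y] msubst_1[OF Z] msubst_1[OF YZ])
qed

lemma msubst_id:
  assumes "power_series f"
  shows "msubst f mvar = f"
  by (rule filtered_linear_eqI[OF filtered_linear_msubst[OF order_ge_mvar] filtered_linear_id assms])
    (simp_all add: msubst_1[OF order_ge_mvar] msubst_mvar_mult[OF order_ge_mvar])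

lemma mrename_eq_msubst:
  assumes \<iota>: "inj \<iota>" and f: "power_series f"
  shows "mrename \<iota> f = msubst f (\<lambda>j. mvar (\<iota> j))"
proof (rule filtered_linear_eqI[OF filtered_linear_mrename[OF \<iota>] filtered_linear_msubst f])
  fix j g assume "power_series g" "mrename \<iota> g = msubst g (\<lambda>j. mvar (\<iota> j))"
  then show "mrename \<iota> (mvar j * g) = msubst (mvar j * g) (\<lambda>j. mvar (\<iota> j))"
    using \<iota> by (simp add: mrename_mult mrename_mvar msubst_mvar_mult[OF order_ge_mvar])
qed (simp_all add: msubst_1[OF order_ge_mvar] order_ge_mvar del: One_nat_def)

lemma msubst_mrename:
  assumes \<iota>: "inj \<iota>" and f: "power_series f" and Z: "\<And>i. order_ge 1 (Z i)"
  shows "msubst (mrename \<iota> f) Z = msubst f (\<lambda>j. Z (\<iota> j))"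
  unfolding mrename_eq_msubst[OF \<iota> f]
  by (subst msubst_msubst[OF order_ge_mvar Z f]) (simp add: msubst_mvar[OF Z])

lemma mrename_msubst:
  assumes \<iota>: "inj \<iota>" and f: "power_series f" and Y: "\<And>j. order_ge 1 (Y j)"
  shows "mrename \<iota> (msubst f Y) = msubst f (\<lambda>j. mrename \<iota> (Y j))"
proof -
  have "mrename \<iota> (msubst f Y) = msubst (msubst f Y) (\<lambda>j. mvar (\<iota> j))"
    by (rule mrename_eq_msubst[OF \<iota> power_series_msubst[OF Y f]])
  also have "\<dots> = msubst f (\<lambda>j. msubst (Y j) (\<lambda>j. mvar (\<iota> j)))"
    by (rule msubst_msubst[OF Y order_ge_mvar f])
  also have "\<dots> = msubst f (\<lambda>j. mrename \<iota> (Y j))"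
    using order_ge_power_series[OF Y] by (simp add: mrename_eq_msubst[OF \<iota>])
  finally show ?thesis .
qed

text \<open>The chain rule.\<close>

lemma mderiv_msubst:
  fixes Y :: "'v::finite \<Rightarrow> 'w::finite mlaurent"
  assumes Y: "\<And>j. order_ge 1 (Y j)" and f: "power_series f"
  shows "mderiv s (msubst f Y) = (\<Sum>j\<in>UNIV. msubst (mderiv j f) Y * mderiv s (Y j))"
proof -
  note FL = filtered_linear_msubst[OF Y]
  have L: "filtered_linear 1 (\<lambda>f. mderiv s (msubst f Y))"
    by (rule filtered_linear_comp[OF FL filtered_linear_mderiv])
  have *: "filtered_linear 1 (\<lambda>f. msubst (mderiv j f) Y)" for j
  proof (rule filtered_linearI)
    show "order_ge n (msubst (mderiv j f) Y)" if "order_ge (n + 1) f" for n f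
      using that by (intro order_ge_msubst[OF Y] order_ge_mderiv) simp
  qed (simp_all add: mderiv_add mderiv_mult power_series_mderiv msubst_add[OF Y]
      msubst_mconst_mult[OF Y])
  have ps: "power_series (mderiv s (Y j))" for j
    using power_series_mderiv order_ge_power_series Y by blast
  have R: "filtered_linear 1 (\<lambda>f. \<Sum>j\<in>UNIV. msubst (mderiv j f) Y * mderiv s (Y j))"
    using filtered_linear_mult[OF * ps] by (intro filtered_linear_sum_fun) (simp add: mult.commute)
  show ?thesis
  proof (rule filtered_linear_eqI[OF L R f])
    fix i g assume g: "power_series g"
      and IH: "mderiv s (msubst g Y) = (\<Sum>j\<in>UNIV. msubst (mderiv j g) Y * mderiv s (Y j))"
    have "(\<Sum>j\<in>UNIV. msubst (mderiv j (mvar i * g)) Y * mderiv s (Y j))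
        = (\<Sum>j\<in>UNIV. (if j = i then msubst g Y * mderiv s (Y i) else 0)
            + Y i * (msubst (mderiv j g) Y * mderiv s (Y j)))"
    proof (rule sum.cong[OF refl])
      fix j
      have "msubst (mderiv j (mvar i * g)) Y
          = msubst ((if j = i then g else 0) + mvar i * mderiv j g) Y"
        by (simp add: mderiv_mult mderiv_mvar)
      also have "\<dots> = (if j = i then msubst g Y else 0) + Y i * msubst (mderiv j g) Y"
        using g power_series_mderiv[OF g]
        by (subst msubst_add[OF Y])
          (simp_all add: msubst_mvar_mult[OF Y] msubst_0[OF Y] power_series_mult)
      finally show "msubst (mderiv j (mvar i * g)) Y * mderiv s (Y j)
          = (if j = i then msubst g Y * mderiv s (Y i) else 0)
            + Y i * (msubst (mderiv j g) Y * mderiv s (Y j))"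
        by (simp add: algebra_simps)
    qed
    also have "\<dots> = mderiv s (Y i) * msubst g Y + Y i * mderiv s (msubst g Y)"
      by (simp add: sum.distrib sum_distrib_left IH mult.commute)
    also have "\<dots> = mderiv s (msubst (mvar i * g) Y)"
      by (simp add: msubst_mvar_mult[OF Y g] mderiv_mult)
    finally show "mderiv s (msubst (mvar i * g) Y)
        = (\<Sum>j\<in>UNIV. msubst (mderiv j (mvar i * g)) Y * mderiv s (Y j))" ..
  qed (simp add: msubst_1[OF Y] msubst_0[OF Y])
qed

lemma mcoeff_msubst_0:
  assumes Y: "\<And>j. order_ge 1 (Y j)" and f: "power_series f"
  shows "mcoeff (msubst f Y) 0 = mcoeff f 0"
proof -
  have "order_ge 1 (f - mconst (mcoeff f 0))"
    unfolding order_ge_1 using f by (simp add: power_series_diff mcoeff_diff)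
  then have "order_ge 1 (msubst (f - mconst (mcoeff f 0)) Y)" by (rule order_ge_msubst[OF Y])
  then show ?thesis
    unfolding order_ge_1 using f by (simp add: msubst_diff[OF Y] msubst_mconst[OF Y] mcoeff_diff)
qed

section \<open>Fixed points, units and the inverse function theorem\<close>

text \<open>
  The contraction principle for tuples of power series: a map that improves the agreement of two
  tuples by one order has a fixed point, the limit of its iterates at \<open>0\<close>.
\<close>

lemma contraction_fixed_point:
  fixes T :: "('i \<Rightarrow> 'w::finite mlaurent) \<Rightarrow> 'i \<Rightarrow> 'w mlaurent"
  assumes T: "\<And>Y j. (\<And>i. order_ge r (Y i)) \<Longrightarrow> order_ge r (T Y j)"
    and contr: "\<And>n Y Z j. (\<And>i. order_ge r (Y i)) \<Longrightarrow> (\<And>i. order_ge r (Z i)) \<Longrightarrow>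
      (\<And>i. order_ge n (Y i - Z i)) \<Longrightarrow> order_ge (Suc n) (T Y j - T Z j)"
  obtains Y where "\<And>j. order_ge r (Y j)" "T Y = Y"
proof -
  define S where "S = (\<lambda>N. (T ^^ N) (\<lambda>_. 0))"
  have S_Suc: "S (Suc N) = T (S N)" for N by (simp add: S_def)
  have S: "order_ge r (S N j)" for N j
    by (induction N arbitrary: j) (simp add: S_def, simp add: S_Suc T)
  have step: "order_ge N (S (Suc N) j - S N j)" for N j
  proof (induction N arbitrary: j)
    case 0
    show ?case
      unfolding order_ge_0 by (intro power_series_diff order_ge_power_series[OF S])
  next
    case (Suc N)
    show ?case
      unfolding S_Suc[of "Suc N"] unfolding S_Suc[of N, symmetric]
      using contr[OF S S Suc] by (simp add: S_Suc)
  qed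
  have cauchy: "order_ge N (S (N + p) j - S N j)" for N p j
  proof (induction p)
    case (Suc p)
    have "order_ge N (S (Suc (N + p)) j - S (N + p) j)"
      using step by (rule order_ge_mono) simp
    from order_ge_add[OF this Suc] show ?case by simp
  qed simp
  define c where "c = (\<lambda>j m. mcoeff (S (Suc (nat (total_degree m))) j) m)"
  \<comment> \<open>The coefficients of degree \<open>d\<close> no longer change from the iterate \<open>d + 1\<close> on.\<close>
  define Y where "Y = (\<lambda>j. Abs_mlaurent (c j))"
  have c_nonneg: "0 \<le> m $ t" if "c j m \<noteq> 0" for j m t
    using order_geD(1)[OF S] that by (simp add: c_def)
  then have "c j \<in> {f. \<exists>N. \<forall>k j. f k \<noteq> 0 \<longrightarrow> N \<le> k $ j}" for j by blast
  then have coeff: "mcoeff (Y j) m = c j m" for j m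
    by (simp add: Y_def Abs_mlaurent_inverse)
  have Y: "order_ge r (Y j)" for j
    unfolding order_ge_def coeff c_def using S by (auto dest: order_geD)
  have limit: "order_ge N (Y j - S N j)" for N j
    unfolding order_ge_def
  proof (intro allI impI)
    fix m assume m: "mcoeff (Y j - S N j) m \<noteq> 0"
    have nonneg: "0 \<le> m $ t" for t
      using m c_nonneg[of j m] order_geD(1)[OF S, of N j m]
      by (cases "c j m = 0") (auto simp: mcoeff_diff coeff)
    have "int N \<le> total_degree m"
    proof (rule ccontr)
      assume *: "\<not> int N \<le> total_degree m"
      define d where "d = Suc (nat (total_degree m))"
      have d: "total_degree m < int d" "d \<le> N"
        using * total_degree_nonneg[of m, OF nonneg] by (auto simp: d_def)
      then have "order_ge d (S N j - S d j)" using cauchy[of d "N - d" j] by simp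
      then have "mcoeff (S N j - S d j) m = 0" using order_geD(2)[of d _ m] d(1) by force
      then show False using m by (simp add: mcoeff_diff coeff c_def d_def)
    qed
    then show "(\<forall>j. 0 \<le> m $ j) \<and> int N \<le> total_degree m" using nonneg by blast
  qed
  have "T Y j = Y j" for j
  proof -
    have "order_ge N (T Y j - Y j)" for N
    proof -
      have "order_ge N (T Y j - S (Suc N) j)"
        unfolding S_Suc by (rule order_ge_mono[OF contr[OF Y S limit]]) simp
      moreover have "order_ge N (Y j - S (Suc N) j)"
        using limit by (rule order_ge_mono) simp
      ultimately have "order_ge N ((T Y j - S (Suc N) j) - (Y j - S (Suc N) j))"
        by (rule order_ge_diff)
      then show ?thesis by simp
    qed
    then show ?thesis using order_ge_all_imp_0[of "T Y j - Y j"] by simp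
  qed
  then show ?thesis using Y that by blast
qed

lemma power_series_unit:
  assumes f: "power_series f" and "mcoeff f 0 = 1"
  obtains g where "power_series g" "f * g = 1" "mcoeff g 0 = 1"
proof -
  \<comment> \<open>The inverse of \<open>f\<close> is the solution of \<open>y = 1 + (1 - f) y\<close>.\<close>
  define T where "T = (\<lambda>(Y :: unit \<Rightarrow> _) (j :: unit). 1 + (1 - f) * Y j)"
  have f1: "order_ge 1 (1 - f)"
    unfolding order_ge_1 using assms by (simp add: power_series_diff mcoeff_diff one_mlaurent.rep_eq)
  obtain Y where Y: "\<And>j. order_ge 0 (Y j)" "T Y = Y"
  proof (rule contraction_fixed_point[of 0 T])
    fix Y :: "unit \<Rightarrow> 'a mlaurent" and j assume "\<And>i. order_ge 0 (Y i)"
    then show "order_ge 0 (T Y j)"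
      using f by (simp add: T_def order_ge_0 power_series_add power_series_mult power_series_diff)
  next
    fix n and Y Z :: "unit \<Rightarrow> 'a mlaurent" and j assume "\<And>i. order_ge n (Y i - Z i)"
    from order_ge_mult[OF f1 this] show "order_ge (Suc n) (T Y j - T Z j)"
      by (simp add: T_def algebra_simps)
  qed blast
  have "1 + (1 - f) * Y () = Y ()" using fun_cong[OF Y(2), of "()"] by (simp add: T_def)
  then have *: "f * Y () = 1" by (simp add: algebra_simps)
  have ps: "power_series (Y ())" using Y(1) by (simp add: order_ge_0)
  have "mcoeff (Y ()) 0 = mcoeff (f * Y ()) 0" using mcoeff_mult_0[OF f ps] assms(2) by simp
  then show ?thesis using that[OF ps *] by (simp add: * one_mlaurent.rep_eq)
qed

text \<open>
  Substitution in \<open>f\<close> does not worsen the agreement of two tuples, and it improves the agreement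
  by one order if \<open>f\<close> has neither constant nor linear terms.
\<close>

lemma msubst_diff_order:
  assumes Y: "\<And>j. order_ge 1 (Y j)" and Z: "\<And>j. order_ge 1 (Z j)"
    and YZ: "\<And>j. order_ge n (Y j - Z j)"
  shows "power_series f \<Longrightarrow> order_ge n (msubst f Y - msubst f Z)"
    and "order_ge 2 f \<Longrightarrow> order_ge (Suc n) (msubst f Y - msubst f Z)"
proof -
  note \<Delta> = filtered_linear_diff[OF filtered_linear_msubst[OF Y] filtered_linear_msubst[OF Z]]
  have mult_eq: "msubst (mvar j * f) Y - msubst (mvar j * f) Z
      = (Y j - Z j) * msubst f Y + Z j * (msubst f Y - msubst f Z)" if "power_series f" for j f
    unfolding msubst_mvar_mult[OF Y that] msubst_mvar_mult[OF Z that] by (simp add: algebra_simps)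
  have n: "order_ge n (msubst f Y - msubst f Z)" if f: "power_series f" for f
  proof (rule filtered_linear_order_ge[OF \<Delta>, of 0])
    fix k :: "int ^ 'a" assume "\<And>j. 0 \<le> k $ j"
    then show "order_ge n (msubst (mmonom k) Y - msubst (mmonom k) Z)"
    proof (induction rule: mmonom_induct)
      case one
      show ?case by (simp add: msubst_1[OF Y] msubst_1[OF Z])
    next
      case (mult j k)
      then have ps: "power_series (mmonom k)"
        by (intro order_ge_power_series[OF order_ge_mmonom, of _ 0]) (simp_all add: total_degree_nonneg)
      have "order_ge n ((Y j - Z j) * msubst (mmonom k) Y)"
        unfolding mult.commute[of "Y j - Z j"]
        by (rule order_ge_mult_left[OF power_series_msubst[OF Y ps] YZ])
      moreover have "order_ge n (Z j * (msubst (mmonom k) Y - msubst (mmonom k) Z))"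
        using order_ge_mult_left[OF order_ge_power_series[OF Z] mult.IH] .
      ultimately show ?case unfolding mult_eq[OF ps] by (rule order_ge_add)
    qed
  qed (use f in \<open>simp add: order_ge_0\<close>)
  then show "power_series f \<Longrightarrow> order_ge n (msubst f Y - msubst f Z)" .
  show "order_ge (Suc n) (msubst f Y - msubst f Z)" if f: "order_ge 2 f"
  proof (rule filtered_linear_order_ge[OF \<Delta> f])
    fix k :: "int ^ 'a" assume k: "\<And>j. 0 \<le> k $ j" "int 2 \<le> total_degree k"
    then have "k \<noteq> 0" by (auto simp: total_degree_def)
    then obtain j where j: "k $ j \<noteq> 0" by (auto simp: vec_eq_iff)
    define l where "l = k - axis j 1"
    have "0 \<le> l $ i" for i
      using k(1)[of i] j by (cases "i = j") (auto simp: l_def axis_def)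
    then have l: "order_ge 1 (mmonom l)"
      using k(2) by (intro order_ge_mmonom) (simp_all add: l_def total_degree_diff)
    note ps = order_ge_power_series[OF l]
    have kl: "mmonom k = mvar j * mmonom l" by (simp add: mvar_def mmonom_mult l_def)
    have "order_ge (n + 1) ((Y j - Z j) * msubst (mmonom l) Y)"
      by (rule order_ge_mult[OF YZ order_ge_msubst[OF Y l]])
    moreover have "order_ge (1 + n) (Z j * (msubst (mmonom l) Y - msubst (mmonom l) Z))"
      by (rule order_ge_mult[OF Z n[OF ps]])
    ultimately show "order_ge (Suc n) (msubst (mmonom k) Y - msubst (mmonom k) Z)"
      unfolding kl mult_eq[OF ps] by (simp add: order_ge_add)
  qed
qed

section \<open>The group of formal diffeomorphisms\<close>

text \<open>
  The composition \<open>X(Y(u))\<close>. It is meaningful if the entries of \<open>X\<close> are power series and those of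
  \<open>Y\<close> are power series without constant term.
\<close>

definition mcompose :: "'n::finite mlaurent ^ 'n \<Rightarrow> 'n mlaurent ^ 'n \<Rightarrow> 'n mlaurent ^ 'n"
  where "mcompose X Y = (\<chi> i. msubst (X $ i) (($) Y))"

text \<open>The identity \<open>u \<mapsto> u\<close>.\<close>

definition mident :: "'n::finite mlaurent ^ 'n"
  where "mident = (\<chi> i. mvar i)"

text \<open>The linear part of a tuple of power series.\<close>

definition linear_part :: "'n::finite mlaurent ^ 'n \<Rightarrow> real ^ 'n ^ 'n"
  where "linear_part X = (\<chi> i j. mcoeff (X $ i) (axis j 1))"

lemma formal_diffeos_iff:
  "X \<in> formal_diffeos \<longleftrightarrow> (\<forall>i. order_ge 1 (X $ i)) \<and> invertible (linear_part X)"
  unfolding formal_diffeos_def linear_part_def order_ge_1 by simp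

lemma linear_part_eq_mderiv: "linear_part X $ i $ j = mcoeff (mderiv j (X $ i)) 0"
  by (simp add: linear_part_def mderiv.rep_eq)

lemma linear_part_mident: "linear_part mident = mat 1"
  by (auto simp: linear_part_eq_mderiv mident_def mderiv_mvar mat_def vec_eq_iff
      one_mlaurent.rep_eq zero_mlaurent.rep_eq)

lemma linear_part_mcompose:
  assumes X: "\<And>i. order_ge 1 (X $ i)" and Y: "\<And>i. order_ge 1 (Y $ i)"
  shows "linear_part (mcompose X Y) = linear_part X ** linear_part Y"
proof -
  note psX = order_ge_power_series[OF X] and psY = order_ge_power_series[OF Y]
  have "linear_part (mcompose X Y) $ i $ j
      = (\<Sum>s\<in>UNIV. linear_part X $ i $ s * linear_part Y $ s $ j)" for i j
    unfolding linear_part_eq_mderiv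
    by (simp add: mcompose_def mderiv_msubst[OF Y psX] mcoeff_sum mcoeff_mult_0
        power_series_msubst[OF Y] power_series_mderiv psX psY mcoeff_msubst_0[OF Y])
  then show ?thesis by (simp add: vec_eq_iff matrix_matrix_mult_def)
qed

lemma order_ge_mcompose:
  assumes "order_ge 1 (X $ i)" "\<And>i. order_ge 1 (Y $ i)"
  shows "order_ge 1 (mcompose X Y $ i)"
  unfolding mcompose_def by (simp add: order_ge_msubst[OF assms(2) assms(1)] del: One_nat_def)

lemma mcompose_mcompose:
  assumes X: "\<And>i. order_ge 1 (X $ i)" and Y: "\<And>i. order_ge 1 (Y $ i)"
    and Z: "\<And>i. order_ge 1 (Z $ i)"
  shows "mcompose (mcompose X Y) Z = mcompose X (mcompose Y Z)"
proof -
  have "($) (mcompose Y Z) = (\<lambda>j. msubst (Y $ j) (($) Z))"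
    by (simp add: mcompose_def fun_eq_iff)
  then have "mcompose (mcompose X Y) Z $ i = mcompose X (mcompose Y Z) $ i" for i
    using msubst_msubst[OF Y Z order_ge_power_series[OF X], of i] by (simp add: mcompose_def)
  then show ?thesis by (simp add: vec_eq_iff)
qed

lemma mcompose_mident:
  fixes X :: "'a::finite mlaurent ^ 'a"
  assumes X: "\<And>i. order_ge 1 (X $ i)"
  shows "mcompose X mident = X" "mcompose mident X = X"
proof -
  have "($) (mident :: 'a mlaurent ^ 'a) = mvar" by (simp add: mident_def fun_eq_iff)
  then show "mcompose X mident = X"
    using msubst_id[OF order_ge_power_series[OF X]] by (simp add: mcompose_def vec_eq_iff)
  show "mcompose mident X = X"
    using msubst_mvar[of "($) X", OF X] by (simp add: mcompose_def mident_def vec_eq_iff)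
qed

lemma mcompose_formal_diffeos:
  assumes "X \<in> formal_diffeos" "Y \<in> formal_diffeos"
  shows "mcompose X Y \<in> formal_diffeos"
proof -
  have X: "order_ge 1 (X $ i)" and Y: "order_ge 1 (Y $ i)" for i
    using assms by (simp_all add: formal_diffeos_iff)
  show ?thesis
    using assms order_ge_mcompose[OF X Y]
    by (simp add: formal_diffeos_iff linear_part_mcompose[OF X Y] invertible_mult)
qed

text \<open>
  The inverse function theorem. Write \<open>X(u) = L u + R(u)\<close> with \<open>L\<close> linear and \<open>R\<close> of order at
  least \<open>2\<close>; then \<open>X(Y(u)) = u\<close> says that \<open>Y\<close> is a fixed point of the contraction
  \<open>Y \<mapsto> L\<^sup>-\<^sup>1 (u - R(Y))\<close>.
\<close>

lemma formal_diffeo_right_inverse: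
  fixes X :: "'n::finite mlaurent ^ 'n"
  assumes "X \<in> formal_diffeos"
  obtains Y where "Y \<in> formal_diffeos" "mcompose X Y = mident"
proof -
  have X: "order_ge 1 (X $ i)" for i using assms by (simp add: formal_diffeos_iff)
  define L where "L = linear_part X"
  define M where "M = matrix_inv L"
  have "invertible L" using assms by (simp add: formal_diffeos_iff L_def)
  then have LM: "L ** M = mat 1" by (simp add: M_def matrix_inv_invertible(1))
  define R where "R = (\<lambda>i. X $ i - (\<Sum>j\<in>UNIV. mconst (L $ i $ j) * mvar j))"
  define T where "T = (\<lambda>Y j. \<Sum>i\<in>UNIV. mconst (M $ j $ i) * (mvar i - msubst (R i) Y))"
  have R: "order_ge 2 (R i)" for i
    unfolding order_ge_def
  proof (intro allI impI)
    fix k assume k: "mcoeff (R i) k \<noteq> 0"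
    have R1: "order_ge 1 (R i)"
      unfolding R_def by (intro order_ge_diff X order_ge_sum order_ge_mconst_mult order_ge_mvar)
    have "mcoeff (R i) (axis j 1) = 0" for j
    proof -
      have "(axis j 1 = (axis s 1 :: int ^ 'n)) = (s = j)" for s by (auto simp: axis_eq_axis)
      then show ?thesis
        by (simp add: R_def mcoeff_diff mcoeff_sum mcoeff_mconst_mult mvar_def mmonom.rep_eq
            L_def linear_part_def if_distrib cong: if_cong)
    qed
    then have not_axis: "k \<noteq> axis j 1" for j using k by auto
    have nonneg: "0 \<le> k $ j" for j by (rule order_geD(1)[OF R1 k])
    have "1 \<le> total_degree k" using order_geD(2)[OF R1 k] by simp
    then have "k \<noteq> 0" by (auto simp: total_degree_def)
    then obtain j where j: "k $ j \<noteq> 0" by (auto simp: vec_eq_iff)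
    have "0 \<le> (k - axis j 1) $ i" for i
      using nonneg[of i] j by (cases "i = j") (auto simp: axis_def)
    then have "1 \<le> total_degree (k - axis j 1)"
      using not_axis[of j] by (intro total_degree_pos) auto
    then show "(\<forall>j. 0 \<le> k $ j) \<and> int 2 \<le> total_degree k"
      using nonneg by (simp add: total_degree_diff)
  qed
  note psR = order_ge_power_series[OF R]
  obtain Y where Y: "\<And>j. order_ge 1 (Y j)" "T Y = Y"
  proof (rule contraction_fixed_point[of 1 T])
    fix Y :: "'n \<Rightarrow> 'n mlaurent" and j assume Y: "\<And>i. order_ge 1 (Y i)"
    have "order_ge 1 (R i)" for i by (rule order_ge_mono[OF R]) simp
    then show "order_ge 1 (T Y j)"
      unfolding T_def
      by (intro order_ge_sum order_ge_mconst_mult order_ge_diff order_ge_mvar order_ge_msubst[OF Y])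
  next
    fix n and Y Z :: "'n \<Rightarrow> 'n mlaurent" and j
    assume Y: "\<And>i. order_ge 1 (Y i)" and Z: "\<And>i. order_ge 1 (Z i)"
      and YZ: "\<And>i. order_ge n (Y i - Z i)"
    have "T Y j - T Z j = - (\<Sum>i\<in>UNIV. mconst (M $ j $ i) * (msubst (R i) Y - msubst (R i) Z))"
      by (simp add: T_def sum_subtractf[symmetric] sum_negf[symmetric] algebra_simps)
    then show "order_ge (Suc n) (T Y j - T Z j)"
      using msubst_diff_order(2)[OF Y Z YZ R]
      by (simp only:) (intro order_ge_minus order_ge_sum order_ge_mconst_mult)
  qed blast
  have XY: "msubst (X $ k) Y = mvar k" for k
  proof -
    define V where "V = (\<lambda>i. mvar i - msubst (R i) Y)"
    have Y_eq: "Y j = (\<Sum>i\<in>UNIV. mconst (M $ j $ i) * V i)" for j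
      using fun_cong[OF Y(2), of j] by (simp add: T_def V_def)
    have "X $ k = (\<Sum>j\<in>UNIV. mconst (L $ k $ j) * mvar j) + R k" by (simp add: R_def)
    then have "msubst (X $ k) Y = (\<Sum>j\<in>UNIV. mconst (L $ k $ j) * Y j) + msubst (R k) Y"
      using psR by (simp add: msubst_add[OF Y(1)] msubst_sum[OF Y(1)] msubst_mconst_mult[OF Y(1)]
          msubst_mvar[OF Y(1)] power_series_sum power_series_mult)
    also have "(\<Sum>j\<in>UNIV. mconst (L $ k $ j) * Y j)
        = (\<Sum>j\<in>UNIV. \<Sum>i\<in>UNIV. mconst (L $ k $ j * M $ j $ i) * V i)"
      by (subst Y_eq) (simp add: sum_distrib_left mconst_mult mult.assoc)
    also have "\<dots> = (\<Sum>i\<in>UNIV. mconst ((L ** M) $ k $ i) * V i)"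
      by (subst sum.swap) (simp add: matrix_matrix_mult_def mconst_sum sum_distrib_right)
    also have "\<dots> = (\<Sum>i\<in>UNIV. if i = k then V i else 0)"
      by (rule sum.cong) (auto simp: LM mat_def)
    also have "\<dots> + msubst (R k) Y = mvar k" by (simp add: V_def)
    finally show ?thesis .
  qed
  define Y' where "Y' = (\<chi> j. Y j)"
  have Y': "order_ge 1 (Y' $ j)" for j using Y(1) by (simp add: Y'_def)
  have comp: "mcompose X Y' = mident"
  proof -
    have "($) Y' = Y" by (simp add: Y'_def fun_eq_iff)
    then show ?thesis by (simp add: vec_eq_iff mcompose_def mident_def XY)
  qed
  have "L ** linear_part Y' = mat 1"
    using linear_part_mcompose[OF X Y'] by (simp add: comp linear_part_mident L_def)
  then have "invertible (linear_part Y')"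
    using matrix_left_right_inverse by (auto simp: invertible_def)
  then have "Y' \<in> formal_diffeos" using Y' by (simp add: formal_diffeos_iff)
  then show ?thesis using comp that by blast
qed

lemma formal_diffeo_inverse:
  assumes "X \<in> formal_diffeos"
  obtains Y where "Y \<in> formal_diffeos" "mcompose X Y = mident" "mcompose Y X = mident"
proof -
  obtain Y where Y: "Y \<in> formal_diffeos" "mcompose X Y = mident"
    using formal_diffeo_right_inverse[OF assms] .
  \<comment> \<open>The right inverse has a right inverse itself, which then equals \<open>X\<close>.\<close>
  obtain Z where Z: "Z \<in> formal_diffeos" "mcompose Y Z = mident"
    using formal_diffeo_right_inverse[OF Y(1)] .
  have order: "order_ge 1 (W $ i)" if "W \<in> formal_diffeos" for W :: "'a mlaurent ^ 'a" and i
    using that by (simp add: formal_diffeos_iff)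
  have "X = mcompose X (mcompose Y Z)" using Z(2) order[OF assms] by (simp add: mcompose_mident)
  also have "\<dots> = mcompose (mcompose X Y) Z"
    by (rule mcompose_mcompose[symmetric]) (rule order, fact)+
  also have "\<dots> = Z" using Y(2) order[OF Z(1)] by (simp add: mcompose_mident)
  finally show ?thesis using that Y Z by blast
qed

section \<open>Jacobian matrices\<close>

lemma map_entries_mrename_mult:
  "inj \<iota> \<Longrightarrow> map_entries (mrename \<iota>) (A ** B)
    = map_entries (mrename \<iota>) A ** map_entries (mrename \<iota>) B"
  by (simp add: vec_eq_iff matrix_matrix_mult_def mrename_sum mrename_mult)

lemma map_entries_mrename_1: "map_entries (mrename \<iota>) (mat 1) = mat 1"
  by (simp add: vec_eq_iff mat_def)

lemma map_entries_msubst_mult: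
  assumes "\<And>j. order_ge 1 (Y j)"
    and "\<And>i j. power_series (A $ i $ j)" "\<And>i j. power_series (B $ i $ j)"
  shows "map_entries (\<lambda>f. msubst f Y) (A ** B)
    = map_entries (\<lambda>f. msubst f Y) A ** map_entries (\<lambda>f. msubst f Y) B"
  by (simp add: vec_eq_iff matrix_matrix_mult_def msubst_sum[of Y, OF assms(1)]
      msubst_mult[of Y, OF assms(1)] assms(2,3) power_series_mult)

lemma map_entries_msubst_1:
  assumes "\<And>j. order_ge 1 (Y j)"
  shows "map_entries (\<lambda>f. msubst f Y) (mat 1) = mat 1"
  by (simp add: vec_eq_iff mat_def msubst_1[of Y, OF assms] msubst_0[of Y, OF assms])

lemma mjacobian_mcompose:
  assumes X: "\<And>i. order_ge 1 (X $ i)" and Y: "\<And>i. order_ge 1 (Y $ i)"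
  shows "mjacobian (mcompose X Y) = map_entries (\<lambda>f. msubst f (($) Y)) (mjacobian X) ** mjacobian Y"
  by (simp add: vec_eq_iff mjacobian_def mcompose_def matrix_matrix_mult_def
      mderiv_msubst[of "($) Y", OF Y order_ge_power_series[OF X]])

lemma mjacobian_mident: "mjacobian mident = mat 1"
  by (auto simp: vec_eq_iff mjacobian_def mident_def mderiv_mvar mat_def)

lemma power_series_mjacobian:
  "order_ge 1 (X $ i) \<Longrightarrow> power_series (mjacobian X $ i $ j)"
  by (simp add: mjacobian_def power_series_mderiv[OF order_ge_power_series] del: One_nat_def)

lemma msubst_mcompose:
  assumes Y: "\<And>i. order_ge 1 (Y $ i)" and X: "\<And>i. order_ge 1 (X $ i)" and f: "power_series f"
  shows "msubst (msubst f (($) Y)) (($) X) = msubst f (($) (mcompose Y X))"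
proof -
  have "($) (mcompose Y X) = (\<lambda>j. msubst (Y $ j) (($) X))"
    by (simp add: mcompose_def fun_eq_iff)
  then show ?thesis using msubst_msubst[of "($) Y" "($) X", OF Y X f] by simp
qed

lemma msubst_mident:
  fixes f :: "'a::finite mlaurent"
  shows "power_series f \<Longrightarrow> msubst f (($) mident) = f"
proof -
  assume "power_series f"
  moreover have "($) (mident :: 'a mlaurent ^ 'a) = mvar" by (simp add: mident_def fun_eq_iff)
  ultimately show ?thesis by (simp add: msubst_id)
qed

text \<open>The inverse of \<open>X\<^sub>*\<close> is \<open>(X\<^sup>-\<^sup>1)\<^sub>*\<close> at the point \<open>X(u)\<close>.\<close>

lemma mjacobian_inverse:
  fixes X Y :: "'n::finite mlaurent ^ 'n"
  assumes X: "\<And>i. order_ge 1 (X $ i)" and Y: "\<And>i. order_ge 1 (Y $ i)"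
    and XY: "mcompose X Y = mident" and YX: "mcompose Y X = mident"
  shows "map_entries (\<lambda>f. msubst f (($) X)) (mjacobian Y) ** mjacobian X = mat 1"
    and "mjacobian X ** map_entries (\<lambda>f. msubst f (($) X)) (mjacobian Y) = mat 1"
proof -
  let ?s = "\<lambda>X. map_entries (\<lambda>f. msubst f (($) X))"
  show "?s X (mjacobian Y) ** mjacobian X = mat 1"
    using mjacobian_mcompose[OF Y X] by (simp add: YX mjacobian_mident)
  have "?s Y (mjacobian X) ** mjacobian Y = mat 1"
    using mjacobian_mcompose[OF X Y] by (simp add: XY mjacobian_mident)
  then have "mat 1 = ?s X (?s Y (mjacobian X) ** mjacobian Y)"
    by (simp add: map_entries_msubst_1[of "($) X", OF X])
  also have "\<dots> = ?s X (?s Y (mjacobian X)) ** ?s X (mjacobian Y)"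
    by (intro map_entries_msubst_mult X)
      (simp_all add: power_series_msubst[of "($) Y", OF Y] power_series_mjacobian[OF X]
        power_series_mjacobian[OF Y])
  also have "?s X (?s Y (mjacobian X)) = mjacobian X"
    by (simp add: vec_eq_iff msubst_mcompose[OF Y X power_series_mjacobian[OF X]] YX
        msubst_mident power_series_mjacobian[OF X])
  finally show "mjacobian X ** ?s X (mjacobian Y) = mat 1" ..
qed

section \<open>Push-forward as a group action\<close>

text \<open>The map \<open>(u,v) \<mapsto> (X(u),X(v))\<close>.\<close>

definition doubled :: "'n::finite mlaurent ^ 'n \<Rightarrow> 'n + 'n \<Rightarrow> ('n + 'n) mlaurent"
  where "doubled X = case_sum (\<lambda>s. mrename Inl (X $ s)) (\<lambda>s. mrename Inr (X $ s))"

lemma doubled_simps [simp]: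
  "doubled X (Inl s) = mrename Inl (X $ s)" "doubled X (Inr s) = mrename Inr (X $ s)"
  by (simp_all add: doubled_def)

lemma order_ge_doubled:
  assumes "\<And>i. order_ge 1 (X $ i)"
  shows "order_ge 1 (doubled X t)"
  by (cases t) (simp_all add: order_ge_mrename[OF inj_Inl assms] order_ge_mrename[OF inj_Inr assms]
      del: One_nat_def)

lemma msubst_doubled:
  assumes X: "\<And>i. order_ge 1 (X $ i)" and f: "power_series f"
  shows "msubst (mrename Inl f) (doubled X) = mrename Inl (msubst f (($) X))"
    and "msubst (mrename Inr f) (doubled X) = mrename Inr (msubst f (($) X))"
proof -
  have "msubst (mrename Inl f) (doubled X) = msubst f (\<lambda>j. doubled X (Inl j))"
    by (rule msubst_mrename[OF inj_Inl f order_ge_doubled[OF X]])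
  then show "msubst (mrename Inl f) (doubled X) = mrename Inl (msubst f (($) X))"
    by (simp add: mrename_msubst[OF inj_Inl f, of "($) X", OF X])
  have "msubst (mrename Inr f) (doubled X) = msubst f (\<lambda>j. doubled X (Inr j))"
    by (rule msubst_mrename[OF inj_Inr f order_ge_doubled[OF X]])
  then show "msubst (mrename Inr f) (doubled X) = mrename Inr (msubst f (($) X))"
    by (simp add: mrename_msubst[OF inj_Inr f, of "($) X", OF X])
qed

lemma msubst_doubled_mcompose:
  assumes Y: "\<And>i. order_ge 1 (Y $ i)" and X: "\<And>i. order_ge 1 (X $ i)" and f: "power_series f"
  shows "msubst (msubst f (doubled Y)) (doubled X) = msubst f (doubled (mcompose Y X))"
proof -
  have "(\<lambda>t. msubst (doubled Y t) (doubled X)) = doubled (mcompose Y X)"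
  proof
    fix t
    show "msubst (doubled Y t) (doubled X) = doubled (mcompose Y X) t"
      using msubst_doubled[OF X order_ge_power_series[OF Y]]
      by (cases t) (simp_all add: mcompose_def)
  qed
  then show ?thesis
    using msubst_msubst[of "doubled Y" "doubled X", OF order_ge_doubled[OF Y] order_ge_doubled[OF X] f]
    by simp
qed

lemma msubst_doubled_mident:
  fixes f :: "('n::finite + 'n) mlaurent"
  assumes "power_series f"
  shows "msubst f (doubled mident) = f"
proof -
  have "doubled (mident :: 'n mlaurent ^ 'n) = mvar"
  proof
    show "doubled (mident :: 'n mlaurent ^ 'n) t = mvar t" for t
      by (cases t) (simp_all add: mident_def mrename_mvar)
  qed
  then show ?thesis using msubst_id[OF assms] by simp
qed

text \<open>
  In matrix form, the push-forward \<open>\<psi>\<close> of \<open>\<phi>\<close> satisfies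
  \<open>\<psi>(X(u),X(v)) = X\<^sub>*(u) \<phi>(u,v) X\<^sub>*(v)\<^sup>T\<close>.
\<close>

lemma push_forward_iff:
  "push_forward X \<phi> \<psi> \<longleftrightarrow> power_series_bivector \<psi> \<and>
    map_entries (\<lambda>f. msubst f (doubled X)) \<psi>
      = map_entries (mrename Inl) (mjacobian X) ** \<phi>
        ** transpose (map_entries (mrename Inr) (mjacobian X))"
proof -
  have "(A ** \<phi> ** transpose B) $ i $ j
      = (\<Sum>k\<in>UNIV. \<Sum>l\<in>UNIV. A $ i $ k * B $ j $ l * \<phi> $ k $ l)"
    for A B :: "('a + 'a) mlaurent ^ 'a ^ 'a" and i j
  proof -
    have "(A ** \<phi> ** transpose B) $ i $ j
        = (\<Sum>l\<in>UNIV. \<Sum>k\<in>UNIV. A $ i $ k * B $ j $ l * \<phi> $ k $ l)"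
      unfolding matrix_matrix_mult_def transpose_def vec_lambda_beta sum_distrib_right
      by (intro sum.cong refl) (simp only: mult.commute mult.left_commute)
    then show ?thesis by (subst sum.swap)
  qed
  then show ?thesis
    by (simp add: push_forward_def doubled_def vec_eq_iff)
qed

lemma push_forward_mcompose:
  assumes X: "\<And>i. order_ge 1 (X $ i)" and Y: "\<And>i. order_ge 1 (Y $ i)"
    and \<psi>: "push_forward X \<phi> \<psi>" and \<rho>: "push_forward Y \<psi> \<rho>"
  shows "push_forward (mcompose Y X) \<phi> \<rho>"
proof -
  let ?s = "map_entries (\<lambda>f. msubst f (doubled X))"
  let ?t = "map_entries (\<lambda>f. msubst f (($) X))"
  let ?l = "map_entries (mrename (Inl :: 'a \<Rightarrow> 'a + 'a))"
  let ?r = "map_entries (mrename (Inr :: 'a \<Rightarrow> 'a + 'a))"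
  note D = order_ge_doubled[OF X]
  note psY = power_series_mjacobian[OF Y]
  have ps\<psi>: "power_series (\<psi> $ i $ j)" and ps\<rho>: "power_series (\<rho> $ i $ j)" for i j
    using \<psi> \<rho> by (simp_all add: push_forward_iff power_series_bivector_def)
  have ps: "power_series (?l (mjacobian Y) $ i $ j)"
    "power_series (transpose (?r (mjacobian Y)) $ i $ j)"
    for i j
    by (simp_all add: transpose_def power_series_mrename psY)
  have "map_entries (\<lambda>f. msubst f (doubled (mcompose Y X))) \<rho>
      = ?s (map_entries (\<lambda>f. msubst f (doubled Y)) \<rho>)"
    by (simp add: vec_eq_iff msubst_doubled_mcompose[OF Y X ps\<rho>])
  also have "\<dots> = ?s (?l (mjacobian Y) ** \<psi> ** transpose (?r (mjacobian Y)))"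
    using \<rho> by (simp add: push_forward_iff)
  also have "\<dots> = ?s (?l (mjacobian Y) ** \<psi>) ** ?s (transpose (?r (mjacobian Y)))"
    by (rule map_entries_msubst_mult[OF D _ ps(2)])
      (simp add: matrix_matrix_mult_def power_series_sum power_series_mult ps(1)[simplified] ps\<psi>)
  also have "?s (?l (mjacobian Y) ** \<psi>) = ?s (?l (mjacobian Y)) ** ?s \<psi>"
    by (rule map_entries_msubst_mult[OF D ps(1) ps\<psi>])
  also have "?s \<psi> = ?l (mjacobian X) ** \<phi> ** transpose (?r (mjacobian X))"
    using \<psi> by (simp add: push_forward_iff)
  also have "?s (?l (mjacobian Y)) = ?l (?t (mjacobian Y))"
    by (simp add: vec_eq_iff msubst_doubled(1)[OF X psY])
  also have "?s (transpose (?r (mjacobian Y))) = transpose (?r (?t (mjacobian Y)))"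
    by (simp add: vec_eq_iff transpose_def msubst_doubled(2)[OF X psY])
  finally show ?thesis
    using \<rho> by (simp add: push_forward_iff mjacobian_mcompose[OF Y X] map_entries_mrename_mult
        matrix_transpose_mul matrix_mul_assoc)
qed

lemma push_forward_inverse:
  assumes X: "\<And>i. order_ge 1 (X $ i)" and Y: "\<And>i. order_ge 1 (Y $ i)"
    and XY: "mcompose X Y = mident" and YX: "mcompose Y X = mident"
    and \<phi>: "power_series_bivector \<phi>" and \<psi>: "push_forward X \<phi> \<psi>"
  shows "push_forward Y \<psi> \<phi>"
proof -
  let ?s = "map_entries (\<lambda>f. msubst f (doubled Y))"
  let ?t = "map_entries (\<lambda>f. msubst f (($) Y))"
  let ?l = "map_entries (mrename (Inl :: 'a \<Rightarrow> 'a + 'a))"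
  let ?r = "map_entries (mrename (Inr :: 'a \<Rightarrow> 'a + 'a))"
  note D = order_ge_doubled[OF Y]
  note psX = power_series_mjacobian[OF X]
  have ps\<psi>: "power_series (\<psi> $ i $ j)" and ps\<phi>: "power_series (\<phi> $ i $ j)" for i j
    using \<psi> \<phi> by (simp_all add: push_forward_iff power_series_bivector_def)
  have ps: "power_series (?l (mjacobian X) $ i $ j)"
    "power_series (transpose (?r (mjacobian X)) $ i $ j)"
    for i j
    by (simp_all add: transpose_def power_series_mrename psX)
  have "\<psi> = ?s (map_entries (\<lambda>f. msubst f (doubled X)) \<psi>)"
    by (simp add: vec_eq_iff msubst_doubled_mcompose[OF X Y ps\<psi>] XY msubst_doubled_mident ps\<psi>)
  also have "\<dots> = ?s (?l (mjacobian X) ** \<phi> ** transpose (?r (mjacobian X)))"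
    using \<psi> by (simp add: push_forward_iff)
  also have "\<dots> = ?s (?l (mjacobian X) ** \<phi>) ** ?s (transpose (?r (mjacobian X)))"
    by (rule map_entries_msubst_mult[OF D _ ps(2)])
      (simp add: matrix_matrix_mult_def power_series_sum power_series_mult ps(1)[simplified] ps\<phi>)
  also have "?s (?l (mjacobian X) ** \<phi>) = ?s (?l (mjacobian X)) ** ?s \<phi>"
    by (rule map_entries_msubst_mult[OF D ps(1) ps\<phi>])
  also have "?s (?l (mjacobian X)) = ?l (?t (mjacobian X))"
    by (simp add: vec_eq_iff msubst_doubled(1)[OF Y psX])
  also have "?s (transpose (?r (mjacobian X))) = transpose (?r (?t (mjacobian X)))"
    by (simp add: vec_eq_iff transpose_def msubst_doubled(2)[OF Y psX])
  finally have \<psi>_eq: "\<psi> = ?l (?t (mjacobian X)) ** ?s \<phi> ** transpose (?r (?t (mjacobian X)))" .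
  have inv: "mjacobian Y ** ?t (mjacobian X) = mat 1"
    by (rule mjacobian_inverse(2)[OF Y X YX XY])
  have "?l (mjacobian Y) ** \<psi> ** transpose (?r (mjacobian Y))
      = (?l (mjacobian Y) ** ?l (?t (mjacobian X))) ** ?s \<phi>
        ** transpose (?r (mjacobian Y) ** ?r (?t (mjacobian X)))"
    by (subst \<psi>_eq) (simp add: matrix_transpose_mul matrix_mul_assoc)
  also have "\<dots> = ?s \<phi>"
    by (simp add: map_entries_mrename_mult[symmetric] inv map_entries_mrename_1 transpose_mat)
  finally show ?thesis using \<phi> by (simp add: push_forward_iff)
qed

lemma orbit_eq:
  assumes X: "X \<in> formal_diffeos" and \<phi>: "power_series_bivector \<phi>" and \<psi>: "push_forward X \<phi> \<psi>"
  shows "{\<rho>. \<exists>Z\<in>formal_diffeos. push_forward Z \<phi> \<rho>} = {\<rho>. \<exists>Z\<in>formal_diffeos. push_forward Z \<psi> \<rho>}"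
proof -
  obtain Y where Y: "Y \<in> formal_diffeos" "mcompose X Y = mident" "mcompose Y X = mident"
    using formal_diffeo_inverse[OF X] .
  have order: "order_ge 1 (Z $ i)" if "Z \<in> formal_diffeos" for Z :: "'a mlaurent ^ 'a" and i
    using that by (simp add: formal_diffeos_iff)
  have inv: "push_forward Y \<psi> \<phi>"
    by (rule push_forward_inverse[OF order[OF X] order[OF Y(1)] Y(2,3) \<phi> \<psi>])
  show ?thesis
  proof (intro set_eqI iffI; clarsimp)
    fix \<rho> Z assume "Z \<in> formal_diffeos" "push_forward Z \<phi> \<rho>"
    then show "\<exists>Z\<in>formal_diffeos. push_forward Z \<psi> \<rho>"
      using push_forward_mcompose[OF order[OF Y(1)] order inv] mcompose_formal_diffeos Y(1) by blast
  next
    fix \<rho> Z assume "Z \<in> formal_diffeos" "push_forward Z \<psi> \<rho>"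
    then show "\<exists>Z\<in>formal_diffeos. push_forward Z \<phi> \<rho>"
      using push_forward_mcompose[OF order[OF X] order \<psi>] mcompose_formal_diffeos X by blast
  qed
qed

section \<open>The Yang--Baxter equation\<close>

text \<open>
  The bivector \<open>a(u) \<otimes> b(v) - b(u) \<otimes> a(v)\<close> of two formal vector fields, each given by the family of
  its components.
\<close>

definition wedge :: "('n::finite \<Rightarrow> 'n mlaurent) \<Rightarrow> ('n \<Rightarrow> 'n mlaurent) \<Rightarrow> 'n bivector"
  where "wedge a b = (\<chi> i j.
    mrename Inl (a i) * mrename Inr (b j) - mrename Inl (b i) * mrename Inr (a j))"

lemma at_vars_wedge:
  assumes "inj (case_sum x y)"
  shows "at_vars x y (wedge a b $ i $ j)
    = mrename x (a i) * mrename y (b j) - mrename x (b i) * mrename y (a j)"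
proof -
  have "case_sum x y \<circ> Inl = x" "case_sum x y \<circ> Inr = y" by (simp_all add: fun_eq_iff)
  then show ?thesis
    by (simp add: at_vars_def wedge_def mrename_diff mrename_mult assms mrename_mrename)
qed

lemma inj_case_sum:
  assumes "inj x" "inj y" "\<And>s t. x s \<noteq> y t"
  shows "inj (case_sum x y)"
  using assms by (auto simp: inj_on_def split: sum.splits) (metis sum.exhaust sum.simps(5,6))+

text \<open>
  The hypothesis says \<open>[b,a] = b\<close>, so \<open>a\<close> and \<open>b\<close> span a Lie algebra. In the six
  terms of the equation, the two that differentiate in the variables \<open>u\<close> combine to a multiple of
  \<open>[b,a](u)\<close>, and likewise for \<open>v\<close> and \<open>w\<close>; after replacing \<open>[b,a]\<close> by \<open>b\<close> the three
  contributions cancel.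
\<close>

lemma cybe_lhs_wedge:
  fixes a b :: "'n::finite \<Rightarrow> 'n mlaurent"
  assumes bracket: "\<And>i. (\<Sum>s\<in>UNIV. b s * mderiv s (a i) - a s * mderiv s (b i)) = b i"
  shows "cybe_lhs (wedge a b) i j k = 0"
proof -
  define u v w :: "'n \<Rightarrow> 'n + 'n + 'n"
    where "u = Inl" and "v = (\<lambda>s. Inr (Inl s))" and "w = (\<lambda>s. Inr (Inr s))"
  have inj: "inj u" "inj v" "inj w" by (auto simp: u_def v_def w_def inj_on_def)
  have notin: "u s \<notin> range v" "u s \<notin> range w" "v s \<notin> range u" "v s \<notin> range w"
    "w s \<notin> range u" "w s \<notin> range v" for s
    by (auto simp: u_def v_def w_def)
  have inj2: "inj (case_sum u v)" "inj (case_sum v u)" "inj (case_sum u w)" "inj (case_sum w u)"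
    "inj (case_sum v w)" "inj (case_sum w v)"
    by (intro inj_case_sum inj; simp add: u_def v_def w_def)+
  note simps = at_vars_wedge[OF inj2(1)] at_vars_wedge[OF inj2(2)] at_vars_wedge[OF inj2(3)]
    at_vars_wedge[OF inj2(4)] at_vars_wedge[OF inj2(5)] at_vars_wedge[OF inj2(6)]
    mderiv_diff mderiv_mult mderiv_mrename[OF inj(1)] mderiv_mrename[OF inj(2)]
    mderiv_mrename[OF inj(3)] mderiv_mrename_notin[OF notin(1)] mderiv_mrename_notin[OF notin(2)]
    mderiv_mrename_notin[OF notin(3)] mderiv_mrename_notin[OF notin(4)]
    mderiv_mrename_notin[OF notin(5)] mderiv_mrename_notin[OF notin(6)]
  define L where "L = (\<lambda>x s i. mrename x (b s) * mrename x (mderiv s (a i))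
    - mrename x (a s) * mrename x (mderiv s (b i)) :: ('n + 'n + 'n) mlaurent)"
  have L: "(\<Sum>s\<in>UNIV. L x s i) = mrename x (b i)" if "inj x" for x i
    using arg_cong[OF bracket[of i], of "mrename x"] that
    by (simp add: L_def mrename_sum mrename_diff mrename_mult)
  have "cybe_lhs (wedge a b) i j k = (\<Sum>s\<in>UNIV.
      (mrename v (b j) * mrename w (a k) - mrename v (a j) * mrename w (b k)) * L u s i
    + (mrename w (b k) * mrename u (a i) - mrename w (a k) * mrename u (b i)) * L v s j
    + (mrename u (b i) * mrename v (a j) - mrename u (a i) * mrename v (b j)) * L w s k)"
    unfolding cybe_lhs_def Let_def u_def[symmetric] v_def[symmetric] w_def[symmetric]
    by (rule sum.cong[OF refl]) (simp only: simps L_def, simp add: algebra_simps)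
  also have "\<dots> = 0"
    by (simp only: sum.distrib sum_distrib_left[symmetric] L inj) (simp add: algebra_simps)
  finally show ?thesis .
qed

lemma wedge_antisym: "wedge a b $ i $ j = - at_vars Inr Inl (wedge a b $ j $ i)"
proof -
  have "inj (case_sum Inr Inl :: 'a + 'a \<Rightarrow> 'a + 'a)" by (rule inj_case_sum) auto
  then show ?thesis by (simp add: at_vars_wedge) (simp add: wedge_def algebra_simps)
qed

lemma wedge_cybe_solution:
  assumes "\<And>i. power_series (a i)" "\<And>i. power_series (b i)"
    and "\<And>i. (\<Sum>s\<in>UNIV. b s * mderiv s (a i) - a s * mderiv s (b i)) = b i"
  shows "wedge a b \<in> cybe_solutions"
proof -
  have "power_series_bivector (wedge a b)"
    unfolding power_series_bivector_def wedge_def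
    by (simp add: assms(1,2) power_series_diff power_series_mult power_series_mrename)
  then show ?thesis
    unfolding cybe_solutions_def mem_Collect_eq
    by (intro conjI allI wedge_antisym cybe_lhs_wedge assms(3))
qed

lemma transform_wedge:
  "map_entries (mrename Inl) A ** wedge a b ** transpose (map_entries (mrename Inr) A)
    = wedge (\<lambda>i. \<Sum>k\<in>UNIV. A $ i $ k * a k) (\<lambda>i. \<Sum>k\<in>UNIV. A $ i $ k * b k)"
proof -
  have *: "(P ** (\<chi> i j. p i * q j - r i * t j) ** transpose Q) $ i $ j
    = (\<Sum>k\<in>UNIV. P $ i $ k * p k) * (\<Sum>l\<in>UNIV. Q $ j $ l * q l)
      - (\<Sum>k\<in>UNIV. P $ i $ k * r k) * (\<Sum>l\<in>UNIV. Q $ j $ l * t l)"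
    for P Q :: "('a + 'a) mlaurent ^ 'a ^ 'a" and p q r t i j
  proof -
    have "(\<Sum>k\<in>UNIV. P $ i $ k * (p k * q l - r k * t l))
        = (\<Sum>k\<in>UNIV. P $ i $ k * p k) * q l - (\<Sum>k\<in>UNIV. P $ i $ k * r k) * t l" for l
      by (simp add: right_diff_distrib sum_subtractf sum_distrib_right mult.assoc)
    note inner = this
    have "(P ** (\<chi> i j. p i * q j - r i * t j) ** transpose Q) $ i $ j
      = (\<Sum>l\<in>UNIV. (\<Sum>k\<in>UNIV. P $ i $ k * p k) * (Q $ j $ l * q l)
        - (\<Sum>k\<in>UNIV. P $ i $ k * r k) * (Q $ j $ l * t l))"
      unfolding matrix_matrix_mult_def transpose_def vec_lambda_beta inner
      by (intro sum.cong refl) (simp add: algebra_simps)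
    then show ?thesis by (simp add: sum_subtractf sum_distrib_left)
  qed
  show ?thesis
    unfolding wedge_def by (simp add: vec_eq_iff * mrename_sum mrename_mult)
qed

section \<open>The bivector of a coordinate system\<close>

text \<open>
  The components, in the coordinates \<open>u\<close>, of the vector fields \<open>\<Sum>\<^sub>k \<partial>/\<partial>F\<^sup>k\<close> and
  \<open>\<Sum>\<^sub>k F\<^sup>k \<partial>/\<partial>F\<^sup>k\<close>.
\<close>

definition translation_field :: "'n::finite mlaurent ^ 'n \<Rightarrow> 'n \<Rightarrow> 'n mlaurent"
  where "translation_field F i = (\<Sum>k\<in>UNIV. matrix_inv (mjacobian F) $ i $ k)"

definition euler_field :: "'n::finite mlaurent ^ 'n \<Rightarrow> 'n \<Rightarrow> 'n mlaurent"
  where "euler_field F i = (\<Sum>k\<in>UNIV. matrix_inv (mjacobian F) $ i $ k * F $ k)"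

lemma phi_of_eq_wedge: "phi_of F = wedge (euler_field F) (translation_field F)"
proof -
  have *: "(\<Sum>k\<in>UNIV. \<Sum>l\<in>UNIV. x k * y l * (f k - g l))
      = (\<Sum>k\<in>UNIV. x k * f k) * (\<Sum>l\<in>UNIV. y l) - (\<Sum>k\<in>UNIV. x k) * (\<Sum>l\<in>UNIV. y l * g l)"
    for x y f g :: "'a \<Rightarrow> ('a + 'a) mlaurent"
    unfolding sum_product sum_subtractf[symmetric]
    by (intro sum.cong refl) (simp add: algebra_simps)
  show ?thesis
    unfolding phi_of_def wedge_def vec_eq_iff euler_field_def translation_field_def vec_lambda_beta *
    by (simp add: mrename_sum mrename_mult)
qed

text \<open>
  In the coordinates \<open>F\<close> this is \<open>[\<Sum>\<^sub>k \<partial>/\<partial>F\<^sup>k, \<Sum>\<^sub>k F\<^sup>k \<partial>/\<partial>F\<^sup>k] = \<Sum>\<^sub>k \<partial>/\<partial>F\<^sup>k\<close>. The Jacobian matrix of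
  \<open>F\<close> sends the two fields to the tuples \<open>(1,\<dots>,1)\<close> and \<open>F\<close>; differentiating these two equations
  shows that it also sends the bracket to \<open>(1,\<dots>,1)\<close>, because
  second derivatives commute.
\<close>

lemma euler_translation_bracket:
  fixes F :: "'n::finite mlaurent ^ 'n"
  assumes inv: "invertible (mjacobian F)"
  defines "a \<equiv> euler_field F" and "b \<equiv> translation_field F"
  shows "(\<Sum>s\<in>UNIV. b s * mderiv s (a i) - a s * mderiv s (b i)) = b i"
proof -
  define J A where "J = mjacobian F" and "A = matrix_inv J"
  have JA: "J ** A = mat 1" and AJ: "A ** J = mat 1"
    using matrix_inv_invertible[OF inv] by (simp_all add: J_def A_def)
  have cancel_A: "(\<Sum>i\<in>UNIV. J $ p $ i * (\<Sum>k\<in>UNIV. A $ i $ k * x k)) = x p" for p x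
    by (simp only: matrix_mult_sum JA mat_1_sum)
  have Ja: "(\<Sum>i\<in>UNIV. J $ p $ i * a i) = F $ p" and Jb: "(\<Sum>i\<in>UNIV. J $ p $ i * b i) = 1" for p
    using cancel_A[of p "\<lambda>k. F $ k"] cancel_A[of p "\<lambda>k. 1"]
    by (simp_all add: a_def b_def euler_field_def translation_field_def J_def A_def)
  define H where "H = (\<lambda>p s i. mderiv s (J $ p $ i))"
  have H_sym: "H p s i = H p i s" for p s i
    by (simp add: H_def J_def mjacobian_def mderiv_commute)
  have da: "(\<Sum>i\<in>UNIV. J $ p $ i * mderiv s (a i)) = J $ p $ s - (\<Sum>i\<in>UNIV. H p s i * a i)" for p s
    using arg_cong[OF Ja[of p], of "mderiv s"]
    by (simp add: mderiv_sum mderiv_mult sum.distrib H_def eq_diff_eq add.commute)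
      (simp add: J_def mjacobian_def)
  have db: "(\<Sum>i\<in>UNIV. J $ p $ i * mderiv s (b i)) = - (\<Sum>i\<in>UNIV. H p s i * b i)" for p s
    using arg_cong[OF Jb[of p], of "mderiv s"]
    by (simp add: mderiv_sum mderiv_mult sum.distrib H_def eq_neg_iff_add_eq_0 add.commute)
  define c where "c = (\<lambda>i. \<Sum>s\<in>UNIV. b s * mderiv s (a i) - a s * mderiv s (b i))"
  have Jc: "(\<Sum>i\<in>UNIV. J $ p $ i * c i) = 1" for p
  proof -
    have "(\<Sum>i\<in>UNIV. J $ p $ i * c i)
        = (\<Sum>s\<in>UNIV. b s * (\<Sum>i\<in>UNIV. J $ p $ i * mderiv s (a i))
            - a s * (\<Sum>i\<in>UNIV. J $ p $ i * mderiv s (b i)))"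
      unfolding c_def sum_distrib_left
      by (subst sum.swap)
        (simp add: right_diff_distrib sum_subtractf mult.left_commute)
    also have "\<dots> = (\<Sum>s\<in>UNIV. J $ p $ s * b s)
        - (\<Sum>s\<in>UNIV. \<Sum>i\<in>UNIV. H p s i * a i * b s) + (\<Sum>s\<in>UNIV. \<Sum>i\<in>UNIV. H p s i * a s * b i)"
      unfolding da db
      by (simp add: right_diff_distrib sum_subtractf sum.distrib sum_distrib_left ac_simps)
    also have "(\<Sum>s\<in>UNIV. \<Sum>i\<in>UNIV. H p s i * a s * b i) = (\<Sum>s\<in>UNIV. \<Sum>i\<in>UNIV. H p s i * a i * b s)"
      by (subst sum.swap) (simp add: H_sym)
    finally show ?thesis by (simp add: Jb)
  qed
  have "c i = (\<Sum>p\<in>UNIV. A $ i $ p * (\<Sum>l\<in>UNIV. J $ p $ l * c l))"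
    by (simp only: matrix_mult_sum AJ mat_1_sum)
  also have "\<dots> = b i" unfolding Jc by (simp add: b_def translation_field_def A_def J_def)
  finally show ?thesis unfolding c_def .
qed

section \<open>Monomial coordinates up to a formal diffeomorphism\<close>

text \<open>The matrix \<open>D\<close> with its entries regarded as real numbers.\<close>

definition real_matrix :: "nat ^ 'n ^ 'm \<Rightarrow> real ^ 'n ^ 'm"
  where "real_matrix D = (\<chi> i j. real (D $ i $ j))"

lemma invertible_real_matrix:
  fixes D :: "nat ^ 'n ^ 'n::finite"
  assumes "D \<in> nonsingular_nat_matrices"
  shows "invertible (real_matrix D)"
proof -
  have "det (real_matrix D) = of_int (det (\<chi> i j. int (D $ i $ j)))"
    by (simp add: det_def real_matrix_def)
  then show ?thesis using assms by (simp add: invertible_det_nz nonsingular_nat_matrices_def)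
qed

text \<open>
  The logarithmic derivative of a monomial in units \<open>f\<^sub>i\<close> with inverses \<open>W\<^sub>i\<close>.
\<close>

lemma mderiv_prod_power:
  assumes "\<And>i. f i * W i = 1"
  shows "mderiv s (\<Prod>i\<in>A. f i ^ n i)
    = (\<Prod>i\<in>A. f i ^ n i) * (\<Sum>i\<in>A. of_nat (n i) * W i * mderiv s (f i))"
proof (induction A rule: infinite_finite_induct)
  case (insert a A)
  have "mderiv s (f a ^ n a) = f a ^ n a * (of_nat (n a) * W a * mderiv s (f a))"
  proof (cases "n a")
    case (Suc m)
    have "f a ^ n a * W a = f a ^ m * (f a * W a)" by (simp add: Suc ac_simps)
    then have "f a ^ n a * W a = f a ^ m" by (simp add: assms)
    moreover have "f a ^ n a * (of_nat (n a) * W a * mderiv s (f a))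
        = (f a ^ n a * W a) * (of_nat (n a) * mderiv s (f a))"
      by (simp only: ac_simps)
    ultimately have "f a ^ n a * (of_nat (n a) * W a * mderiv s (f a))
        = of_nat (n a) * f a ^ m * mderiv s (f a)"
      by (simp add: ac_simps)
    then show ?thesis by (simp only: mderiv_power) (simp add: Suc)
  qed simp
  then show ?case using insert by (simp add: mderiv_mult algebra_simps)
qed simp_all

text \<open>
  The components of \<open>\<Sum>\<^sub>k F\<^sup>k \<partial>/\<partial>F\<^sup>k\<close> and \<open>\<Sum>\<^sub>k \<partial>/\<partial>F\<^sup>k\<close> in coordinates \<open>z\<close> for which
  \<open>F\<^sup>k\<close> is the monomial with exponents \<open>- d\<^sub>k\<^sub>s\<close> in the \<open>z\<^sup>s\<close>. They are polynomials in \<open>z\<close>, and the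
  argument \<open>z\<close> may be any tuple of series.
\<close>

definition monomial_euler :: "nat ^ 'n ^ 'n \<Rightarrow> ('n::finite \<Rightarrow> 'w::finite mlaurent) \<Rightarrow> 'n \<Rightarrow> 'w mlaurent"
  where "monomial_euler D z i = - z i * (\<Sum>k\<in>UNIV. mconst (matrix_inv (real_matrix D) $ i $ k))"

definition monomial_translation ::
    "nat ^ 'n ^ 'n \<Rightarrow> ('n::finite \<Rightarrow> 'w::finite mlaurent) \<Rightarrow> 'n \<Rightarrow> 'w mlaurent"
  where "monomial_translation D z i = - z i *
    (\<Sum>k\<in>UNIV. mconst (matrix_inv (real_matrix D) $ i $ k) * (\<Prod>s\<in>UNIV. z s ^ (D $ k $ s)))"

lemma power_series_monomial_fields:
  assumes "\<And>s. power_series (z s)"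
  shows "power_series (monomial_euler D z i)" "power_series (monomial_translation D z i)"
  unfolding monomial_euler_def monomial_translation_def
  by (intro power_series_mult power_series_minus power_series_sum power_series_prod
      power_series_power power_series_mconst assms)+

lemma msubst_monomial_fields:
  assumes Y: "\<And>j. order_ge 1 (Y j)"
  shows "msubst (monomial_euler D mvar i) Y = monomial_euler D Y i"
    and "msubst (monomial_translation D mvar i) Y = monomial_translation D Y i"
proof -
  note Y_simps = msubst_mult[of Y, OF Y] msubst_minus[of Y, OF Y] msubst_sum[of Y, OF Y]
    msubst_prod[of Y, OF Y] msubst_power[of Y, OF Y] msubst_mconst[of Y, OF Y] msubst_mvar[of Y, OF Y]
    power_series_mult power_series_minus power_series_sum power_series_prod power_series_power
  show "msubst (monomial_euler D mvar i) Y = monomial_euler D Y i"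
    unfolding monomial_euler_def by (simp add: Y_simps)
  show "msubst (monomial_translation D mvar i) Y = monomial_translation D Y i"
    unfolding monomial_translation_def by (simp add: Y_simps)
qed

text \<open>
  If \<open>F\<^sup>k\<close> is the monomial with exponents \<open>- d\<^sub>k\<^sub>s\<close> in the \<open>X\<^sup>s\<close>, then \<open>X\<close> carries the two fields
  of \<open>F\<close> to the polynomial fields above. As \<open>X\<^sub>*\<close> has an inverse with power series entries, the
  fields of \<open>F\<close> are power series too, although \<open>F\<close> itself has poles.
\<close>

lemma fields_of_monomial_coordinates:
  fixes F X :: "'n::finite mlaurent ^ 'n"
  assumes D: "D \<in> nonsingular_nat_matrices" and X: "X \<in> formal_diffeos"
    and unit: "\<And>i. X $ i dvd 1"
    and F: "\<And>k. F $ k * (\<Prod>s\<in>UNIV. X $ s ^ (D $ k $ s)) = 1"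
  shows "invertible (mjacobian F)"
    and "power_series (euler_field F i)" "power_series (translation_field F i)"
    and "(\<Sum>j\<in>UNIV. mjacobian X $ i $ j * euler_field F j) = monomial_euler D (($) X) i"
    and "(\<Sum>j\<in>UNIV. mjacobian X $ i $ j * translation_field F j) = monomial_translation D (($) X) i"
proof -
  have "\<forall>i. \<exists>w. X $ i * w = 1" using unit by (metis dvdE)
  then obtain W where W: "X $ i * W i = 1" for i by metis
  define M where "M = matrix_inv (real_matrix D)"
  have DM: "real_matrix D ** M = mat 1" and MD: "M ** real_matrix D = mat 1"
    using matrix_inv_invertible[OF invertible_real_matrix[OF D]] by (simp_all add: M_def)
  have DM_nth: "(\<Sum>i\<in>UNIV. real (D $ k $ i) * M $ i $ l) = (if k = l then 1 else 0)" for k l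
    using arg_cong[OF DM, of "\<lambda>A. A $ k $ l"]
    by (simp add: matrix_matrix_mult_def real_matrix_def mat_def)
  have MD_nth: "(\<Sum>k\<in>UNIV. M $ i $ k * real (D $ k $ j)) = (if i = j then 1 else 0)" for i j
    using arg_cong[OF MD, of "\<lambda>A. A $ i $ j"]
    by (simp add: matrix_matrix_mult_def real_matrix_def mat_def)
  define P where "P = (\<lambda>k. \<Prod>s\<in>UNIV. X $ s ^ (D $ k $ s))"
  have FP: "F $ k * P k = 1" for k using F by (simp add: P_def)
  define J where "J = mjacobian X"
  \<comment> \<open>\<open>B\<close> is the Jacobian matrix of the monomials \<open>F\<close> with respect to the coordinates \<open>X\<close>, and
    \<open>C\<close> is its inverse.\<close>
  define B where "B = (\<chi> k i. - (mconst (real (D $ k $ i)) * F $ k * W i))"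
  define C where "C = (\<chi> i k. - (X $ i * mconst (M $ i $ k) * P k))"
  have BC: "B ** C = mat 1"
  proof -
    have "(B ** C) $ k $ l = F $ k * P l * mconst (\<Sum>i\<in>UNIV. real (D $ k $ i) * M $ i $ l)" for k l
    proof -
      have "B $ k $ i * C $ i $ l
          = (X $ i * W i) * (F $ k * P l * (mconst (real (D $ k $ i)) * mconst (M $ i $ l)))" for i
        by (simp add: B_def C_def ac_simps)
      then show ?thesis
        by (simp add: matrix_matrix_mult_def W mconst_sum mconst_mult sum_distrib_left)
    qed
    then show ?thesis by (auto simp: vec_eq_iff DM_nth mat_def FP)
  qed
  have CB: "C ** B = mat 1"
  proof -
    have "(C ** B) $ i $ j = X $ i * W j * mconst (\<Sum>k\<in>UNIV. M $ i $ k * real (D $ k $ j))" for i j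
    proof -
      have "C $ i $ k * B $ k $ j
          = (F $ k * P k) * (X $ i * W j * (mconst (M $ i $ k) * mconst (real (D $ k $ j))))" for k
        by (simp add: B_def C_def ac_simps)
      then show ?thesis
        by (simp add: matrix_matrix_mult_def FP mconst_sum mconst_mult sum_distrib_left)
    qed
    then show ?thesis by (auto simp: vec_eq_iff MD_nth mat_def W)
  qed
  have JF: "mjacobian F = B ** J"
  proof -
    have "mderiv j (F $ k) = (B ** J) $ k $ j" for k j
    proof -
      define S where "S = (\<Sum>i\<in>UNIV. of_nat (D $ k $ i) * W i * mderiv j (X $ i))"
      have "mderiv j (P k) = P k * S"
        unfolding P_def S_def by (rule mderiv_prod_power[OF W])
      then have "mderiv j (F $ k) * P k = - (F $ k * P k * S)"
        using arg_cong[OF FP[of k], of "mderiv j"]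
        by (simp add: mderiv_mult eq_neg_iff_add_eq_0 mult.assoc)
      then have FS: "mderiv j (F $ k) * P k = - S" by (simp add: FP)
      have "mderiv j (F $ k) = mderiv j (F $ k) * (F $ k * P k)" by (simp add: FP)
      also have "\<dots> = F $ k * (mderiv j (F $ k) * P k)" by (simp only: ac_simps)
      also have "\<dots> = - (F $ k * S)" by (simp add: FS)
      also have "\<dots> = (B ** J) $ k $ j"
        by (simp add: matrix_matrix_mult_def B_def J_def mjacobian_def S_def sum_distrib_left
            sum_negf mconst_of_nat ac_simps)
      finally show ?thesis .
    qed
    then show ?thesis by (simp add: vec_eq_iff mjacobian_def)
  qed
  obtain Y where Y: "Y \<in> formal_diffeos" "mcompose X Y = mident" "mcompose Y X = mident"
    using formal_diffeo_inverse[OF X] .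
  have oX: "order_ge 1 (X $ i)" and oY: "order_ge 1 (Y $ i)" for i
    using X Y(1) by (simp_all add: formal_diffeos_iff)
  define E where "E = map_entries (\<lambda>f. msubst f (($) X)) (mjacobian Y)"
  have EJ: "E ** J = mat 1" and JE: "J ** E = mat 1"
    unfolding E_def J_def using mjacobian_inverse[OF oX oY Y(2,3)] by simp_all
  have psE: "power_series (E $ i $ j)" for i j
    by (simp add: E_def power_series_msubst[of "($) X", OF oX] power_series_mjacobian[OF oY])
  have inv1: "mjacobian F ** (E ** C) = mat 1"
    unfolding JF by (metis BC JE matrix_mul_assoc matrix_mul_rid)
  have inv2: "(E ** C) ** mjacobian F = mat 1"
    unfolding JF by (metis CB EJ matrix_mul_assoc matrix_mul_rid)
  have inv: "invertible (mjacobian F)" using inv1 inv2 by (auto simp: invertible_def)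
  then show "invertible (mjacobian F)" .
  have EC: "matrix_inv (mjacobian F) = E ** C"
    using matrix_inv_invertible(1)[OF inv] inv2
    by (metis matrix_mul_assoc matrix_mul_lid matrix_mul_rid)
  have sums: "(\<Sum>l\<in>UNIV. matrix_inv (mjacobian F) $ i $ l * x l)
      = (\<Sum>k\<in>UNIV. E $ i $ k * (\<Sum>l\<in>UNIV. C $ k $ l * x l))" for i x
    by (simp only: EC matrix_mult_sum)
  have cancel: "(\<Sum>j\<in>UNIV. J $ i $ j * (\<Sum>k\<in>UNIV. E $ j $ k * x k)) = x i" for i x
    by (simp only: matrix_mult_sum JE mat_1_sum)
  have euler: "euler_field F i = (\<Sum>k\<in>UNIV. E $ i $ k * monomial_euler D (($) X) k)" for i
  proof -
    have "C $ k $ l * F $ l = - X $ k * mconst (M $ k $ l)" for k l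
    proof -
      have "C $ k $ l * F $ l = - X $ k * mconst (M $ k $ l) * (F $ l * P l)"
        by (simp add: C_def ac_simps)
      then show ?thesis by (simp add: FP)
    qed
    then show ?thesis
      using sums[of i "\<lambda>l. F $ l"]
      by (simp add: euler_field_def monomial_euler_def M_def sum_distrib_left)
  qed
  have translation:
    "translation_field F i = (\<Sum>k\<in>UNIV. E $ i $ k * monomial_translation D (($) X) k)" for i
  proof -
    have "(\<Sum>l\<in>UNIV. C $ k $ l * 1) = monomial_translation D (($) X) k" for k
      by (simp add: C_def monomial_translation_def M_def P_def sum_distrib_left mult.assoc)
    then show ?thesis
      using sums[of i "\<lambda>l. 1"] by (simp add: translation_field_def)
  qed
  show "(\<Sum>j\<in>UNIV. mjacobian X $ i $ j * euler_field F j) = monomial_euler D (($) X) i"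
    unfolding euler J_def[symmetric] by (rule cancel)
  show "(\<Sum>j\<in>UNIV. mjacobian X $ i $ j * translation_field F j) = monomial_translation D (($) X) i"
    unfolding translation J_def[symmetric] by (rule cancel)
  have psX: "power_series (X $ i)" for i by (rule order_ge_power_series[OF oX])
  show "power_series (euler_field F i)" "power_series (translation_field F i)"
    unfolding euler translation
    by (intro power_series_sum power_series_mult psE power_series_monomial_fields psX)+
qed

section \<open>The solution of monomial coordinates is polynomial\<close>

lemma polynomial_mconst: "polynomial (mconst c)"
proof -
  have "finite {k. mcoeff (mconst c) k \<noteq> 0}"
    by (rule finite_subset[of _ "{0}"]) (auto simp: mconst.rep_eq)
  then show ?thesis by (simp add: polynomial_def)
qed

lemma polynomial_mvar: "polynomial (mvar j)"
  unfolding polynomial_def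
  by (simp add: mvar_def[of j] mmonom.rep_eq) (metis mvar_def power_series_mvar)

lemma polynomial_add:
  assumes "polynomial f" "polynomial g"
  shows "polynomial (f + g)"
proof -
  have "finite {k. mcoeff (f + g) k \<noteq> 0}"
    by (rule finite_subset[of _ "{k. mcoeff f k \<noteq> 0} \<union> {k. mcoeff g k \<noteq> 0}"])
      (use assms in \<open>auto simp: polynomial_def plus_mlaurent.rep_eq\<close>)
  then show ?thesis using assms by (simp add: polynomial_def power_series_add)
qed

lemma polynomial_minus: "polynomial f \<Longrightarrow> polynomial (- f)"
  by (simp add: polynomial_def power_series_minus uminus_mlaurent.rep_eq)

lemma polynomial_diff: "polynomial f \<Longrightarrow> polynomial g \<Longrightarrow> polynomial (f - g)"
  using polynomial_add[of f "- g"] by (simp add: polynomial_minus)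

lemma polynomial_mult:
  assumes "polynomial f" "polynomial g"
  shows "polynomial (f * g)"
proof -
  let ?A = "{k. mcoeff f k \<noteq> 0}" and ?B = "{k. mcoeff g k \<noteq> 0}"
  have "{k. mcoeff (f * g) k \<noteq> 0} \<subseteq> (\<lambda>(a, b). a + b) ` (?A \<times> ?B)"
  proof
    fix k assume "k \<in> {k. mcoeff (f * g) k \<noteq> 0}"
    then obtain l where l: "mcoeff f l \<noteq> 0" "mcoeff g (k - l) \<noteq> 0"
      using mcoeff_mult_nonzeroE[of f g k] by blast
    then have "(l, k - l) \<in> ?A \<times> ?B" "k = (\<lambda>(a, b). a + b) (l, k - l)" by simp_all
    then show "k \<in> (\<lambda>(a, b). a + b) ` (?A \<times> ?B)" by blast
  qed
  moreover have "finite ((\<lambda>(a, b). a + b) ` (?A \<times> ?B))"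
    using assms by (simp add: polynomial_def)
  ultimately show ?thesis using assms by (simp add: polynomial_def power_series_mult finite_subset)
qed

lemma polynomial_sum: "(\<And>a. a \<in> A \<Longrightarrow> polynomial (f a)) \<Longrightarrow> polynomial (sum f A)"
  using polynomial_mconst[of 0]
  by (induction A rule: infinite_finite_induct) (auto simp: polynomial_add)

lemma polynomial_prod: "(\<And>a. a \<in> A \<Longrightarrow> polynomial (f a)) \<Longrightarrow> polynomial (prod f A)"
  using polynomial_mconst[of 1]
  by (induction A rule: infinite_finite_induct) (auto simp: polynomial_mult)

lemma polynomial_power: "polynomial f \<Longrightarrow> polynomial (f ^ n)"
  using polynomial_mconst[of 1] by (induction n) (auto simp: polynomial_mult)

lemma polynomial_mrename:
  assumes "inj \<iota>" "polynomial f"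
  shows "polynomial (mrename \<iota> f)"
proof -
  have "{m. mcoeff (mrename \<iota> f) m \<noteq> 0} \<subseteq> extend_exponent \<iota> ` {k. mcoeff f k \<noteq> 0}"
    using mcoeff_mrename_nonzeroE[OF assms(1)] by blast
  then show ?thesis
    using assms by (auto simp: polynomial_def power_series_mrename intro: finite_subset)
qed

lemma polynomial_wedge:
  assumes "\<And>i. polynomial (a i)" "\<And>i. polynomial (b i)"
  shows "polynomial (wedge a b $ i $ j)"
  unfolding wedge_def
  by (simp add: assms polynomial_diff polynomial_mult polynomial_mrename)

lemma polynomial_monomial_fields:
  "polynomial (monomial_euler D mvar i)" "polynomial (monomial_translation D mvar i)"
  unfolding monomial_euler_def monomial_translation_def
  by (intro polynomial_mult polynomial_minus polynomial_sum polynomial_prod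
      polynomial_power polynomial_mconst polynomial_mvar)+

lemma mident_formal_diffeo: "(mident :: 'a::finite mlaurent ^ 'a) \<in> formal_diffeos"
proof -
  have "order_ge 1 ((mident :: 'a mlaurent ^ 'a) $ i)" for i
    unfolding mident_def by (simp add: order_ge_mvar del: One_nat_def)
  then show ?thesis
    by (auto simp: formal_diffeos_iff linear_part_mident invertible_def)
qed

section \<open>The orbit of a non-singular matrix\<close>

text \<open>
  The solution is formally \<open>h = q\<close> raised to the exponent matrix \<open>D\<^sup>-\<^sup>1\<close>. Its existence follows
  from the inverse function theorem for the map with components
  \<open>\<Prod>\<^sub>j (1 + y\<^sub>j)\<^bsup>d\<^sub>i\<^sub>j\<^esup> - 1\<close>, whose linear part is \<open>D\<close>.
\<close>

lemma unipotent_monomial_equations: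
  fixes D :: "nat ^ 'n ^ 'n::finite" and q :: "'n \<Rightarrow> 'w::finite mlaurent"
  assumes D: "D \<in> nonsingular_nat_matrices"
    and q: "\<And>i. power_series (q i)" "\<And>i. mcoeff (q i) 0 = 1"
  shows "\<exists>h. (\<forall>j. power_series (h j) \<and> mcoeff (h j) 0 = 1) \<and>
    (\<forall>i. (\<Prod>j\<in>UNIV. h j ^ (D $ i $ j)) = q i)"
proof -
  define e where "e = (\<lambda>j. 1 + mvar j :: 'n mlaurent)"
  have e: "power_series (e j)" "mcoeff (e j) 0 = 1" for j
    using order_ge_mvar[of j] unfolding order_ge_1
    by (simp_all add: e_def power_series_add mcoeff_simps)
  have "\<exists>w. power_series w \<and> e j * w = 1 \<and> mcoeff w 0 = 1" for j
    using power_series_unit[OF e] by metis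
  then obtain w where w: "\<And>j. power_series (w j)" "\<And>j. e j * w j = 1" "\<And>j. mcoeff (w j) 0 = 1"
    by metis
  define G where "G = (\<chi> i. (\<Prod>j\<in>UNIV. e j ^ (D $ i $ j)) - 1)"
  have ps: "power_series (\<Prod>j\<in>UNIV. e j ^ (D $ i $ j))" for i
    by (intro power_series_prod power_series_power e)
  have coeff_power: "mcoeff (e j ^ n) 0 = 1" for j n
    by (induction n) (simp_all add: mcoeff_mult_0 e power_series_power one_mlaurent.rep_eq)
  have coeff_prod: "mcoeff (\<Prod>j\<in>A. e j ^ n j) 0 = 1" for A n
    by (induction A rule: infinite_finite_induct)
      (simp_all add: mcoeff_mult_0 coeff_power e power_series_power power_series_prod one_mlaurent.rep_eq)
  have G: "order_ge 1 (G $ i)" for i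
    unfolding order_ge_1 G_def
    by (simp add: ps power_series_diff mcoeff_diff coeff_prod one_mlaurent.rep_eq)
  have "linear_part G $ i $ s = real (D $ i $ s)" for i s
  proof -
    have term0: "mcoeff (of_nat n * w j * mderiv s (e j)) 0 = (if j = s then real n else 0)" for n j
      using mcoeff_mconst_mult[of "real n" "w j" 0]
      by (auto simp: e_def mderiv_add mderiv_mvar mconst_of_nat[symmetric] w(3) mcoeff_simps)
    have pst: "power_series (of_nat n * w j * mderiv s (e j))" for n j
      unfolding mconst_of_nat[symmetric]
      by (intro power_series_mult power_series_mderiv e w power_series_mconst)
    have "mderiv s (G $ i) = (\<Prod>j\<in>UNIV. e j ^ (D $ i $ j))
        * (\<Sum>j\<in>UNIV. of_nat (D $ i $ j) * w j * mderiv s (e j))"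
      by (simp add: G_def mderiv_diff mderiv_prod_power[OF w(2)])
    then show ?thesis
      by (simp add: linear_part_eq_mderiv mcoeff_mult_0 ps pst power_series_sum coeff_prod
          mcoeff_sum term0)
  qed
  then have "linear_part G = real_matrix D" by (simp add: vec_eq_iff real_matrix_def)
  then have "G \<in> formal_diffeos" using G invertible_real_matrix[OF D] by (simp add: formal_diffeos_iff)
  then obtain K where K: "K \<in> formal_diffeos" "mcompose G K = mident"
    by (rule formal_diffeo_right_inverse)
  have oK: "order_ge 1 (K $ i)" for i using K(1) by (simp add: formal_diffeos_iff)
  define z where "z = (\<lambda>i. q i - 1)"
  have z: "order_ge 1 (z i)" for i
    unfolding order_ge_1 z_def using q by (simp add: power_series_diff mcoeff_diff one_mlaurent.rep_eq)
  define y where "y = (\<lambda>j. msubst (K $ j) z)"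
  have y: "order_ge 1 (y j)" for j unfolding y_def by (rule order_ge_msubst[of z, OF z oK])
  define h where "h = (\<lambda>j. 1 + y j)"
  have "(\<Prod>j\<in>UNIV. h j ^ (D $ i $ j)) = q i" for i
  proof -
    have "msubst (G $ i) y = (\<Prod>j\<in>UNIV. h j ^ (D $ i $ j)) - 1"
      by (simp add: G_def msubst_diff[of y, OF y] ps msubst_prod[of y, OF y] msubst_power[of y, OF y]
          msubst_1[of y, OF y] e power_series_power h_def)
        (simp add: e_def msubst_add[of y, OF y] msubst_1[of y, OF y] msubst_mvar[of y, OF y])
    moreover have "msubst (G $ i) y = msubst (msubst (G $ i) (($) K)) z"
      unfolding y_def
      by (rule msubst_msubst[of "($) K" z, OF oK z order_ge_power_series[OF G], symmetric])
    moreover have "msubst (G $ i) (($) K) = mvar i"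
      using arg_cong[OF K(2), of "\<lambda>X. X $ i"] by (simp add: mcompose_def mident_def)
    moreover have "msubst (mvar i) z = z i" by (rule msubst_mvar[of z, OF z])
    ultimately have "(\<Prod>j\<in>UNIV. h j ^ (D $ i $ j)) - 1 = z i" by simp
    then show ?thesis by (simp add: z_def)
  qed
  moreover have "power_series (h j)" "mcoeff (h j) 0 = 1" for j
    using y[of j] unfolding order_ge_1 h_def by (simp_all add: power_series_add mcoeff_simps)
  ultimately show ?thesis by blast
qed

text \<open>
  Every \<open>F\<close> of type \<open>D\<close> consists of the pure monomials in suitable coordinates: write
  \<open>F\<^sup>i = u\<^bsup>-d\<^sub>i\<^esup> P\<^sub>i\<close> with \<open>P\<^sub>i\<close> a power series of constant term \<open>1\<close>, and put
  \<open>X\<^sup>j = u\<^sup>j h\<^sub>j\<close>, where \<open>\<Prod>\<^sub>j h\<^sub>j\<^bsup>d\<^sub>i\<^sub>j\<^esup> = 1/P\<^sub>i\<close>.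
\<close>

lemma monomial_coordinates:
  fixes D :: "nat ^ 'n ^ 'n::finite"
  assumes D: "D \<in> nonsingular_nat_matrices" and F: "F \<in> tuples_of_type D"
  shows "\<exists>X\<in>formal_diffeos. (\<forall>i. X $ i dvd 1) \<and>
    (\<forall>k. F $ k * (\<Prod>s\<in>UNIV. X $ s ^ (D $ k $ s)) = 1)"
proof -
  obtain f where f: "\<And>i k. mcoeff (F $ i) k = mcoeff (mmonom (neg_row D i)) k +
      (if (\<forall>j. k $ j \<ge> - int (D $ i $ j)) \<and>
          (\<Sum>j\<in>UNIV. k $ j) \<ge> - (\<Sum>j\<in>UNIV. int (D $ i $ j)) + 1
       then f i k else 0)"
    using F unfolding tuples_of_type_def by blast
  define P where "P = (\<lambda>i. mmonom (- neg_row D i) * F $ i)"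
  have coeff: "mcoeff (P i) k = mcoeff (F $ i) (k + neg_row D i)" for i k
    by (simp add: P_def mcoeff_mmonom_mult)
  have psP: "power_series (P i)" for i
    unfolding power_series_def
  proof (intro allI impI)
    fix k j assume "mcoeff (P i) k \<noteq> 0"
    then have "mcoeff (F $ i) (k + neg_row D i) \<noteq> 0" by (simp add: coeff)
    then have "k + neg_row D i = neg_row D i \<or> - int (D $ i $ j) \<le> (k + neg_row D i) $ j"
      unfolding f mmonom.rep_eq by (auto split: if_splits)
    then show "0 \<le> k $ j" by (auto simp: neg_row_def)
  qed
  have P0: "mcoeff (P i) 0 = 1" for i
    unfolding coeff f mmonom.rep_eq by (simp add: neg_row_def sum_negf)
  have "\<exists>q. power_series q \<and> P i * q = 1 \<and> mcoeff q 0 = 1" for i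
    using power_series_unit[OF psP P0] by metis
  then obtain q where q: "\<And>i. power_series (q i)" "\<And>i. P i * q i = 1" "\<And>i. mcoeff (q i) 0 = 1"
    by metis
  obtain h where "\<forall>j. power_series (h j) \<and> mcoeff (h j) 0 = 1"
    "\<forall>i. (\<Prod>j\<in>UNIV. h j ^ (D $ i $ j)) = q i"
    using unipotent_monomial_equations[of D q, OF D q(1,3)] by blast
  then have h: "power_series (h j)" "mcoeff (h j) 0 = 1"
    "(\<Prod>j\<in>UNIV. h j ^ (D $ i $ j)) = q i" for i j
    by blast+
  have "\<exists>g. h j * g = 1" for j
    using power_series_unit[OF h(1,2)] by metis
  then obtain g where g: "\<And>j. h j * g j = 1" by metis
  define X where "X = (\<chi> j. mvar j * h j)"
  define W where "W = (\<lambda>j. mmonom (- axis j 1) * g j)"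
  have "X $ j * W j = (mmonom (axis j 1) * mmonom (- axis j 1)) * (h j * g j)" for j
    unfolding X_def W_def mvar_def by (simp add: ac_simps)
  then have "X $ j * W j = 1" for j by (simp add: g mmonom_inverse)
  then have unit: "X $ j dvd 1" for j by (metis dvd_triv_left)
  have oX: "order_ge 1 (X $ j)" for j
    using order_ge_mult_left[OF h(1) order_ge_mvar, of j j] by (simp add: X_def mult.commute)
  have "linear_part X $ i $ j = mat 1 $ i $ j" for i j
  proof -
    have "mcoeff (mvar i * mderiv j (h i)) 0 = 0"
      using order_ge_mvar[of i] unfolding order_ge_1
      by (simp add: mcoeff_mult_0 power_series_mderiv h)
    then show ?thesis
      by (auto simp: linear_part_eq_mderiv X_def mderiv_mult mderiv_mvar mcoeff_simps h mat_def)
  qed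
  then have "linear_part X = mat 1" by (simp add: vec_eq_iff)
  then have "invertible (linear_part X)" by (auto simp: invertible_def intro: exI[of _ "mat 1"])
  then have "X \<in> formal_diffeos" using oX by (simp add: formal_diffeos_iff)
  moreover have "F $ k * (\<Prod>s\<in>UNIV. X $ s ^ (D $ k $ s)) = 1" for k
  proof -
    have "(\<chi> j. int (D $ k $ j)) = - neg_row D k" by (simp add: vec_eq_iff neg_row_def)
    then have "(\<Prod>s\<in>UNIV. X $ s ^ (D $ k $ s)) = mmonom (- neg_row D k) * q k"
      by (simp add: X_def power_mult_distrib prod.distrib prod_mvar_power h(3))
    then have "F $ k * (\<Prod>s\<in>UNIV. X $ s ^ (D $ k $ s)) = P k * q k"
      by (simp add: P_def ac_simps)
    then show ?thesis by (simp add: q)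
  qed
  ultimately show ?thesis using unit by blast
qed

lemma monomial_tuple_of_type: "monomial_tuple D \<in> tuples_of_type D"
  unfolding tuples_of_type_def mem_Collect_eq
  by (rule exI[of _ "\<lambda>_ _. 0"]) (simp add: monomial_tuple_def)

lemma phi_of_monomial_tuple:
  fixes D :: "nat ^ 'n ^ 'n::finite"
  assumes D: "D \<in> nonsingular_nat_matrices"
  shows "phi_of (monomial_tuple D) = wedge (monomial_euler D mvar) (monomial_translation D mvar)"
proof -
  have id: "($) (mident :: 'n mlaurent ^ 'n) = mvar" by (simp add: mident_def fun_eq_iff)
  have unit: "mident $ i dvd 1" for i :: 'n
    unfolding mident_def mvar_def using mmonom_inverse by (metis dvd_triv_left vec_lambda_beta)
  have F: "monomial_tuple D $ k * (\<Prod>s\<in>UNIV. mident $ s ^ (D $ k $ s)) = 1" for k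
  proof -
    have "(\<chi> j. int (D $ k $ j)) = - neg_row D k" by (simp add: vec_eq_iff neg_row_def)
    then show ?thesis
      by (simp add: mident_def prod_mvar_power monomial_tuple_def mmonom_inverse)
  qed
  have "euler_field (monomial_tuple D) = monomial_euler D mvar"
    "translation_field (monomial_tuple D) = monomial_translation D mvar"
    using fields_of_monomial_coordinates(4,5)[OF D mident_formal_diffeo unit F]
    by (simp_all add: fun_eq_iff mjacobian_mident id mat_1_sum)
  then show ?thesis by (simp add: phi_of_eq_wedge)
qed

lemma msubst_doubled_wedge:
  assumes X: "\<And>i. order_ge 1 (X $ i)" and "\<And>i. power_series (a i)" "\<And>i. power_series (b i)"
  shows "map_entries (\<lambda>f. msubst f (doubled X)) (wedge a b)
    = wedge (\<lambda>i. msubst (a i) (($) X)) (\<lambda>i. msubst (b i) (($) X))"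
  unfolding wedge_def
  by (simp add: vec_eq_iff msubst_diff[of "doubled X", OF order_ge_doubled[OF X]]
      msubst_mult[of "doubled X", OF order_ge_doubled[OF X]] assms(2,3) power_series_mult
      power_series_mrename msubst_doubled[OF X])

lemma phi_of_tuple_of_type:
  fixes D :: "nat ^ 'n ^ 'n::finite"
  assumes D: "D \<in> nonsingular_nat_matrices" and F: "F \<in> tuples_of_type D"
  shows "invertible (mjacobian F)" "phi_of F \<in> cybe_solutions"
    "\<exists>X\<in>formal_diffeos. push_forward X (phi_of F) (phi_of (monomial_tuple D))"
proof -
  obtain X where X: "X \<in> formal_diffeos" and "\<forall>i. X $ i dvd 1"
    and "\<forall>k. F $ k * (\<Prod>s\<in>UNIV. X $ s ^ (D $ k $ s)) = 1"
    using monomial_coordinates[OF D F] by blast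
  then have unit: "X $ i dvd 1" and FX: "F $ k * (\<Prod>s\<in>UNIV. X $ s ^ (D $ k $ s)) = 1" for i k
    by blast+
  note fields = fields_of_monomial_coordinates[OF D X unit FX]
  have oX: "order_ge 1 (X $ i)" for i using X by (simp add: formal_diffeos_iff)
  show "invertible (mjacobian F)" by (rule fields(1))
  show "phi_of F \<in> cybe_solutions"
    unfolding phi_of_eq_wedge
    by (rule wedge_cybe_solution[OF fields(2,3) euler_translation_bracket[OF fields(1)]])
  have psm: "power_series (monomial_euler D mvar i)"
    "power_series (monomial_translation D mvar i)" for i
    by (rule power_series_monomial_fields[OF power_series_mvar])+
  have "map_entries (\<lambda>f. msubst f (doubled X)) (phi_of (monomial_tuple D))
      = wedge (monomial_euler D (($) X)) (monomial_translation D (($) X))"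
    unfolding phi_of_monomial_tuple[OF D] msubst_doubled_wedge[OF oX psm]
    by (simp add: msubst_monomial_fields[of "($) X", OF oX])
  moreover have "map_entries (mrename Inl) (mjacobian X) ** phi_of F
      ** transpose (map_entries (mrename Inr) (mjacobian X))
      = wedge (monomial_euler D (($) X)) (monomial_translation D (($) X))"
    unfolding phi_of_eq_wedge transform_wedge fields(4,5) ..
  moreover have "power_series_bivector (phi_of (monomial_tuple D))"
    using polynomial_wedge[of "monomial_euler D mvar" "monomial_translation D mvar",
        OF polynomial_monomial_fields]
    by (simp add: power_series_bivector_def phi_of_monomial_tuple[OF D] polynomial_def)
  ultimately have "push_forward X (phi_of F) (phi_of (monomial_tuple D))"
    by (simp add: push_forward_iff)
  then show "\<exists>X\<in>formal_diffeos. push_forward X (phi_of F) (phi_of (monomial_tuple D))"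
    using X by blast
qed

theorem theorem6p1:
  fixes D :: "nat ^ 'n ^ 'n::finite"
  assumes "D \<in> nonsingular_nat_matrices"
  shows "(\<forall>F \<in> tuples_of_type D. invertible (mjacobian F) \<and> phi_of F \<in> cybe_solutions) \<and>
    (\<exists>!Orb. Orb \<in> solution_orbits \<and> (\<forall>F \<in> tuples_of_type D. phi_of F \<in> Orb)) \<and>
    phi_of (monomial_tuple D) \<in> cybe_solutions \<and>
    (\<forall>i j. polynomial (phi_of (monomial_tuple D) $ i $ j)) \<and>
    (\<forall>Orb. Orb \<in> solution_orbits \<and> (\<forall>F \<in> tuples_of_type D. phi_of F \<in> Orb) \<longrightarrow>
       phi_of (monomial_tuple D) \<in> Orb)"
proof -
  define \<phi> where "\<phi> = phi_of (monomial_tuple D)"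
  define orbit where
    "orbit = (\<lambda>\<phi> :: 'n bivector. {\<psi>. \<exists>X\<in>formal_diffeos. push_forward X \<phi> \<psi>})"
  have orbits: "solution_orbits = orbit ` cybe_solutions"
    by (auto simp: solution_orbits_def orbit_def)
  have ps: "power_series_bivector \<psi>" if "\<psi> \<in> cybe_solutions" for \<psi> :: "'n bivector"
    using that by (simp add: cybe_solutions_def)
  have eq: "orbit \<psi> = orbit \<rho>" if "\<psi> \<in> cybe_solutions" "\<rho> \<in> orbit \<psi>" for \<psi> \<rho>
    using that(2) orbit_eq[OF _ ps[OF that(1)]] unfolding orbit_def by blast
  have refl: "\<psi> \<in> orbit \<psi>" if "\<psi> \<in> cybe_solutions" for \<psi>
  proof -
    have "map_entries (\<lambda>f. msubst f (doubled mident)) \<psi> = \<psi>"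
      using ps[OF that] by (simp add: vec_eq_iff power_series_bivector_def msubst_doubled_mident)
    then have "push_forward mident \<psi> \<psi>"
      using ps[OF that]
      by (simp add: push_forward_iff mjacobian_mident map_entries_mrename_1 transpose_mat)
    then show ?thesis using mident_formal_diffeo by (auto simp: orbit_def)
  qed
  note phi = phi_of_tuple_of_type[OF assms]
  have \<phi>: "\<phi> \<in> cybe_solutions"
    unfolding \<phi>_def by (rule phi(2)[OF monomial_tuple_of_type])
  have in_orbit: "phi_of F \<in> orbit \<phi>" if F: "F \<in> tuples_of_type D" for F
  proof -
    have "\<phi> \<in> orbit (phi_of F)" using phi(3)[OF F] by (simp add: orbit_def \<phi>_def)
    then have "orbit (phi_of F) = orbit \<phi>" by (rule eq[OF phi(2)[OF F]])
    then show ?thesis using refl[OF phi(2)[OF F]] by simp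
  qed
  have unique: "Orb = orbit \<phi>"
    if "Orb \<in> solution_orbits" "\<forall>F\<in>tuples_of_type D. phi_of F \<in> Orb" for Orb
    using that monomial_tuple_of_type[of D] eq by (auto simp: orbits \<phi>_def)
  have poly: "polynomial (\<phi> $ i $ j)" for i j
    unfolding \<phi>_def phi_of_monomial_tuple[OF assms]
    by (rule polynomial_wedge[OF polynomial_monomial_fields])
  have "\<exists>!Orb. Orb \<in> solution_orbits \<and> (\<forall>F \<in> tuples_of_type D. phi_of F \<in> Orb)"
    by (rule ex1I[of _ "orbit \<phi>"]) (use \<phi> in_orbit unique in \<open>auto simp: orbits\<close>)
  then show ?thesis
    using phi(1,2) \<phi> poly monomial_tuple_of_type[of D] by (auto simp: \<phi>_def)
qed

end
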